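(* Let $n\ge 2$ and let $\gamma$ be an admissible Jordan arc with parametrization $\phi$. Let $f:\gamma\to\mathbb{C}$ be such that $f^{(n-1)}$ exists everywhere on $\gamma$ and $f^{(n-1)}\circ\phi$ is Lipschitz continuous on $[0,1]$. Then for every integer $k$ with $1\le k\le n$ and fixed $z_2,\dots,z_{k+1}\in\gamma$, the function $t_1\mapsto |d_k^{\,n-k}(f\,|\,\phi(t_1),z_2,\dots,z_{k+1})|$ is uniformly bounded almost everywhere on $[0,1]$, and for each $m=0,1,\dots,n-k-1$ the function $t_1\mapsto d_k^{\,m}(f\,|\,\phi(t_1),z_2,\dots,z_{k+1})$ is absolutely continuous on $[0,1]$ once an appropriate value is assigned at $\phi(t_1)=z_{k+1}$. Moreover, for $z_1\ne z_{k+1}$, \[ d_k^{\,m}(f\,|\,z_1,\dots,z_{k+1})=\frac{\int_{z_{k+1}}^{z_1}(z-z_{k+1})^m\, d_{k-1}^{\,m+1}(f\,|\,z,z_2,\dots,z_k)\,dz}{(z_1-z_{k+1})^{m+1}},\qquad k=1,\dots,n,\ m=0,\dots,n-k, \] where $d_n^{\,0}=d_n$ and $d_0^{\,n}=f^{(n)}$.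
   Context: A Jordan arc is the image of $[0,1]$ under a homeomorphism into $\mathbb{C}$; it is admissible if it is the image of a parametrization $\phi\in C^1([0,1])$ with $\phi'(t)\ne0$ for all $t\in[0,1]$ (one-sided at endpoints). For $g$ on $\gamma$, $g'(z_1)=\lim_{z\to z_1,\,z\in\gamma}\frac{g(z)-g(z_1)}{z-z_1}$; higher derivatives are defined inductively. For $z_1=\phi(t_1),z_2=\phi(t_2)$, $\int_{z_2}^{z_1}g(z)\,dz:=\int_{t_2}^{t_1}g(\phi(t))\phi'(t)\,dt$. Divided differences for distinct points are defined recursively by $d_0(f\,|\,z_1)=f(z_1)$ and $d_k(f\,|\,z_1,\dots,z_{k+1})=\frac{d_{k-1}(f\,|\,z_1,z_2,\dots,z_k)-d_{k-1}(f\,|\,z_{k+1},z_2,\dots,z_k)}{z_1-z_{k+1}}$; equivalently $d_n(f\,|\,z_1,\dots,z_{n+1})=\sum_{k=1}^{n+1}f(z_k)/\prod_{i\ne k}(z_k-z_i)$, which is symmetric in the nodes. The notation $d_k^{\,m}(f\,|\,z_1,\dots,z_{k+1})$ denotes the $m$-th derivative (along $\gamma$) of $d_k(f\,|\,z_1,\dots,z_{k+1})$ with respect to $z_1$, the other arguments being fixed. *)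

theory Defs
  imports "HOL-Analysis.Analysis"
begin

definition arc_deriv :: "complex set \<Rightarrow> (complex \<Rightarrow> complex) \<Rightarrow> complex \<Rightarrow> complex" where
  "arc_deriv \<gamma> g z = (SOME D. (g has_field_derivative D) (at z within \<gamma>))"

fun arc_nderiv :: "complex set \<Rightarrow> nat \<Rightarrow> (complex \<Rightarrow> complex) \<Rightarrow> complex \<Rightarrow> complex" where
  "arc_nderiv \<gamma> 0 g = g"
| "arc_nderiv \<gamma> (Suc j) g = arc_deriv \<gamma> (arc_nderiv \<gamma> j g)"

text \<open>Divided difference d_k(f | z 0, ..., z k), by the recursive definition:
  d_k(z_1,...,z_{k+1}) = (d_{k-1}(z_1,...,z_k) - d_{k-1}(z_{k+1},z_2,...,z_k)) / (z_1 - z_{k+1}).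
  Nodes are indexed from 0 here (paper's z_i is z (i-1)).\<close>
primrec divdiff :: "(complex \<Rightarrow> complex) \<Rightarrow> nat \<Rightarrow> (nat \<Rightarrow> complex) \<Rightarrow> complex" where
  "divdiff f 0 z = f (z 0)"
| "divdiff f (Suc k) z = (divdiff f k z - divdiff f k (z(0 := z (Suc k)))) / (z 0 - z (Suc k))"

definition arc_integral :: "(real \<Rightarrow> complex) \<Rightarrow> (real \<Rightarrow> complex) \<Rightarrow> (complex \<Rightarrow> complex) \<Rightarrow> real \<Rightarrow> real \<Rightarrow> complex" where
  "arc_integral \<phi> \<phi>' g a b =
     (if a \<le> b then integral {a..b} (\<lambda>t. g (\<phi> t) * \<phi>' t)
      else - integral {b..a} (\<lambda>t. g (\<phi> t) * \<phi>' t))"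

definition absolutely_continuous_on :: "real \<Rightarrow> real \<Rightarrow> (real \<Rightarrow> 'a::real_normed_vector) \<Rightarrow> bool" where
  "absolutely_continuous_on a b h \<longleftrightarrow>
     (\<forall>\<epsilon>>0. \<exists>\<delta>>0. \<forall>(N::nat) (u::nat \<Rightarrow> real) v.
        (\<forall>i<N. a \<le> u i \<and> u i \<le> v i \<and> v i \<le> b) \<and>
        (\<forall>i<N. \<forall>j<N. i \<noteq> j \<longrightarrow> v i \<le> u j \<or> v j \<le> u i) \<and>
        (\<Sum>i<N. v i - u i) < \<delta>
        \<longrightarrow> (\<Sum>i<N. norm (h (v i) - h (u i))) < \<epsilon>)"

end

theory Submission
  imports Defs
begin

text \<open>
  Write \<open>g_j\<close> for the \<open>j\<close>-th derivative of \<open>g\<close> along the arc and let \<open>H(z) = (g(z) - g(a)) / (z - a)\<close>.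
  Differentiating \<open>(z - a) H = g - g(a)\<close> repeatedly gives \<open>(z - a) H_(m+1) + (m + 1) H_m = g_(m+1)\<close>,
  so the derivative of \<open>(z - a)^(m+1) H_m\<close> is \<open>(z - a)^m g_(m+1)\<close>. Integrating yields the integral
  formula and, by the chord-arc inequality, boundedness of \<open>H_m\<close>; conversely, boundedness of
  \<open>H_(m+1)\<close> shows that \<open>H_m\<close> extends to \<open>a\<close> by \<open>g_(m+1)(a) / (m + 1)\<close>. Hence forming a divided
  difference costs exactly one order of smoothness, and one inducts on \<open>k\<close>. At the top order only
  Lipschitz continuity is available, so the fundamental theorem of calculus is needed for Lipschitz
  functions: the measure with distribution function \<open>F\<close> has a density \<open>w\<close> by Radon--Nikodym, and the
  Vitali covering theorem gives \<open>F' = w\<close> almost everywhere.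
\<close>

section \<open>Almost everywhere differentiability of Lipschitz functions\<close>

text \<open>The Vitali covering theorem extracts countably many disjoint intervals from the fine
  family, and countable additivity sums the inequality over them. Keeping \<open>B\<close> inside
  \<open>U\<close> lets outer regularity control what \<open>B\<close> contains beyond a prescribed
  set.\<close>

lemma Vitali_measure_comparison:
  fixes M N :: "real measure"
  assumes M: "sets M = sets borel" and N: "sets N = sets borel"
    and U: "E \<subseteq> U" "open U"
    and fine: "\<And>x d. x \<in> E \<Longrightarrow> d > 0 \<Longrightarrow>
      \<exists>s t. s < t \<and> x \<in> {s..t} \<and> t - s < d \<and> emeasure M {s..t} \<le> emeasure N {s..t}"
  obtains B where "B \<in> sets borel" "B \<subseteq> U" "negligible (E - B)" "emeasure M B \<le> emeasure N B"
proof -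
  define K where "K = {(s, t). s < t \<and> {s..t} \<subseteq> U \<and> emeasure M {s..t} \<le> emeasure N {s..t}}"
  define a where "a = (\<lambda>i::real\<times>real. (fst i + snd i) / 2)"
  define r where "r = (\<lambda>i::real\<times>real. (snd i - fst i) / 2)"
  have cb: "cball (a i) (r i) = {fst i..snd i}" for i
    by (simp add: cball_eq_atLeastAtMost a_def r_def field_simps)
  have r: "0 < r i" if "i \<in> K" for i
    using that by (auto simp: K_def r_def)
  have K: "\<exists>i. i \<in> K \<and> x \<in> cball (a i) (r i) \<and> r i < d" if x: "x \<in> E" and d: "0 < d" for x d
  proof -
    obtain e where e: "e > 0" "ball x e \<subseteq> U"
      using U x open_contains_ball by blast
    from fine[OF x, of "min d e"] e d obtain s t where st: "s < t" "x \<in> {s..t}" "t - s < min d e"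
      "emeasure M {s..t} \<le> emeasure N {s..t}" by auto
    have "{s..t} \<subseteq> U"
      using e st by (force simp: ball_def dist_real_def)
    with st have "(s, t) \<in> K" by (simp add: K_def)
    moreover have "x \<in> cball (a (s, t)) (r (s, t))"
      unfolding cb using st by simp
    ultimately show ?thesis
      using st by (intro exI[of _ "(s, t)"]) (auto simp: r_def)
  qed
  obtain C where C: "countable C" "C \<subseteq> K"
     "pairwise (\<lambda>i j. disjnt (cball (a i) (r i)) (cball (a j) (r j))) C"
     "negligible(E - (\<Union>i \<in> C. cball (a i) (r i)))"
    using Vitali_covering_theorem_cballs[of K r E a, OF r K] by blast
  define B where "B = (\<Union>i \<in> C. cball (a i) (r i))"
  have disj: "disjoint_family_on (\<lambda>i. cball (a i) (r i)) C"
    using C(3) by (auto simp: disjoint_family_on_def pairwise_def disjnt_def)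
  show ?thesis
  proof
    show "B \<in> sets borel" unfolding B_def using C(1) by auto
    show "B \<subseteq> U" unfolding B_def cb using C(2) by (force simp: K_def)
    show "negligible (E - B)" using C(4) by (simp add: B_def)
    have "emeasure M B = (\<integral>\<^sup>+i. emeasure M (cball (a i) (r i)) \<partial>count_space C)"
      unfolding B_def by (rule emeasure_UN_countable) (use C disj M in auto)
    also have "\<dots> \<le> (\<integral>\<^sup>+i. emeasure N (cball (a i) (r i)) \<partial>count_space C)"
      by (rule nn_integral_mono) (use C(2) in \<open>auto simp: cb K_def\<close>)
    also have "\<dots> = emeasure N B"
      unfolding B_def by (rule emeasure_UN_countable[symmetric]) (use C disj N in auto)
    finally show "emeasure M B \<le> emeasure N B" .
  qed
qed

text \<open>The Vitali argument covers only up to a null set and yields an error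
  \<open>c * e\<close> with \<open>c\<close> independent of \<open>e\<close>. Rescaling
  \<open>e\<close> by \<open>c'\<close>, a positive real above \<open>c\<close>, absorbs the
  constant.\<close>

lemma negligible_outer_borel:
  fixes S :: "real set"
  assumes "c < \<infinity>" and "\<And>e::real. e > 0 \<Longrightarrow>
    \<exists>B \<in> sets borel. negligible (S - B) \<and> emeasure lborel B \<le> c * ennreal e"
  shows "negligible S"
  unfolding negligible_outer_le
proof (intro allI impI)
  fix e :: real assume e: "e > 0"
  define c' where "c' = enn2real c + 1"
  have c': "c' > 0" "c \<le> ennreal c'"
    using assms(1) enn2real_nonneg[of c]
     apply (auto simp: c'_def less_top)
    apply (smt (verit, best) enn2real_nonneg ennreal_enn2real_if ennreal_leI infinity_ennreal_def less_irrefl)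
    done
  obtain B where B: "B \<in> sets borel" "negligible (S - B)" "emeasure lborel B \<le> c * ennreal (e / c')"
    using assms(2)[of "e / c'"] e c' by auto
  have "c * ennreal (e / c') \<le> ennreal c' * ennreal (e / c')"
    using c' by (intro mult_right_mono) auto
  also have "\<dots> = ennreal e"
    using c' e by (simp flip: ennreal_mult'')
  finally have Be: "emeasure lborel B \<le> ennreal e" using B by order
  then have "B \<in> lmeasurable"
    using B(1) by (auto simp: fmeasurable_def less_top[symmetric] top_unique)
  moreover have "measure lebesgue B \<le> e"
    using Be e B(1) by (simp add: measure_def enn2real_leI)
  moreover have S: "S - B \<in> lmeasurable" "measure lebesgue (S - B) = 0"
    using B(2) by (auto simp: negligible_imp_measurable negligible_imp_measure0)
  moreover have "measure lebesgue (B \<union> (S - B)) \<le> measure lebesgue B + measure lebesgue (S - B)"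
    by (rule measure_Un_le) (use B(1) S in auto)
  moreover have "B \<union> (S - B) \<in> lmeasurable"
    using calculation by (intro fmeasurable.Un) auto
  ultimately show "\<exists>T. S \<subseteq> T \<and> T \<in> lmeasurable \<and> measure lebesgue T \<le> e"
    by (intro exI[of _ "B \<union> (S - B)"] conjI) auto
qed

lemma bilipschitz_ae_derivative:
  fixes F :: "real \<Rightarrow> real"
  assumes lo: "\<And>x y. x \<le> y \<Longrightarrow> y - x \<le> F y - F x"
    and hi: "\<And>x y. x \<le> y \<Longrightarrow> F y - F x \<le> M * (y - x)"
  obtains w N where "negligible N" "\<And>x. x \<notin> N \<Longrightarrow> (F has_real_derivative w x) (at x)"
    "\<And>a b. a \<le> b \<Longrightarrow> (w has_integral F b - F a) {a..b}"
proof -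
  have M: "M \<ge> 1" using lo[of 0 1] hi[of 0 1] by simp
  have le_iff: "F x \<le> F y \<longleftrightarrow> x \<le> y" for x y
    using lo[of x y] lo[of y x] by linarith
  have lip: "\<bar>F y - F x\<bar> \<le> M * \<bar>y - x\<bar>" for x y
    using hi[of x y] lo[of x y] hi[of y x] lo[of y x] by (cases "x \<le> y") auto
  have "M-lipschitz_on UNIV F"
    using lip M by (auto simp: lipschitz_on_def dist_real_def)
  then have cont: "continuous_on UNIV F" by (rule lipschitz_on_continuous_on)
  have inj: "inj F" by (rule injI) (metis le_iff order_antisym order_refl)
  have "\<exists>x. F x = y" for y
  proof -
    define R where "R = \<bar>y - F 0\<bar>"
    have "F (- R) \<le> y" "y \<le> F R" "- R \<le> R"
      using lo[of 0 R] lo[of "- R" 0] by (auto simp: R_def)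
    then show "\<exists>x. F x = y"
      using IVT'[of F "- R" y R] continuous_on_subset[OF cont] by auto
  qed
  then have surj: "surj F" by (metis surjI)
  \<comment> \<open>Images under \<open>F\<close> are preimages under \<open>G\<close>, and
    \<open>G\<close> is Borel because it is monotone. Hence \<open>F\<close> maps Borel sets to
    Borel sets and the image measure below is a \<open>distr\<close>.\<close>
  define G where "G = inv F"
  have FG[simp]: "F (G y) = y" for y by (simp add: G_def surj surj_f_inv_f)
  have G_le: "G x \<le> G y \<longleftrightarrow> x \<le> y" "G x \<le> z \<longleftrightarrow> x \<le> F z" "z \<le> G x \<longleftrightarrow> F z \<le> x" for x y z
    using le_iff[of "G x" "G y"] le_iff[of "G x" z] le_iff[of z "G x"] by simp_all
  have GF[simp]: "G (F x) = x" for x by (simp add: G_def inj)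
  have [measurable]: "G \<in> borel_measurable borel"
    by (rule borel_measurable_mono) (simp add: mono_def G_le)
  have img: "F ` A = G -` A" for A
    by (auto simp: image_iff) (metis FG)
  define \<mu> where "\<mu> = distr lborel borel G"
  have sets_\<mu> [simp, measurable_cong]: "sets \<mu> = sets borel" by (simp add: \<mu>_def)
  have em: "emeasure \<mu> A = emeasure lborel (F ` A)" if "A \<in> sets borel" for A
    using that by (simp add: \<mu>_def emeasure_distr img)
  have borel_img: "F ` A \<in> sets borel" if "A \<in> sets borel" for A
    using that measurable_sets[of G borel borel A] by (simp add: img)
  have em_Icc: "emeasure \<mu> {a..b} = ennreal (F b - F a)" if "a \<le> b" for a b
  proof -
    have "F ` {a..b} = {F a..F b}"
      unfolding img by (auto simp: G_le)
    then show ?thesis using that by (simp add: em le_iff)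
  qed
  have ac: "absolutely_continuous lborel \<mu>"
    unfolding absolutely_continuous_def
  proof
    fix A :: "real set" assume A: "A \<in> null_sets lborel"
    then have A': "A \<in> sets borel" by auto
    have "negligible A" using A by (simp add: negligible_iff_null_sets null_sets_completionI)
    then have "negligible (F ` A)"
      by (rule negligible_locally_Lipschitz_image[rotated])
        (auto intro!: exI[of _ UNIV] exI[of _ M] simp: lip)
    then have "emeasure lborel (F ` A) = 0"
      using borel_img[OF A'] by (auto simp: negligible_iff_null_sets null_sets_def)
    then show "A \<in> null_sets \<mu>" using A' by (auto simp: null_sets_def em)
  qed
  obtain W where W[measurable]: "W \<in> borel_measurable borel" and dens: "density lborel W = \<mu>"
    using sigma_finite_measure.Radon_Nikodym[OF sigma_finite_lborel ac] by auto
  have emW: "emeasure \<mu> A = (\<integral>\<^sup>+x. W x * indicator A x \<partial>lborel)" if "A \<in> sets borel" for A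
    using that by (simp add: dens[symmetric] emeasure_density)
  \<comment> \<open>The density is finite almost everywhere because its integral over each interval
    from \<open>-n\<close> to \<open>n\<close> is the finite increment of \<open>F\<close>.\<close>
  have "AE x in lborel. \<forall>n::nat. W x * indicator {-real n..real n} x \<noteq> \<infinity>"
    unfolding AE_all_countable
  proof
    fix n :: nat
    show "AE x in lborel. W x * indicator {-real n..real n} x \<noteq> \<infinity>"
      by (rule nn_integral_noteq_infinite)
        (use em_Icc[of "- real n" "real n"] emW[of "{- real n..real n}"] in auto)
  qed
  moreover have "W x \<noteq> \<infinity>" if "\<forall>n::nat. W x * indicator {-real n..real n} x \<noteq> \<infinity>" for x
  proof -
    obtain n where "\<bar>x\<bar> \<le> real n" using real_arch_simple by blast
    with spec[OF that, of n] show ?thesis by (auto simp: indicator_def abs_le_iff split: if_splits)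
  qed
  ultimately have fin: "AE x in lborel. W x \<noteq> \<infinity>" by auto
  define w where "w = (\<lambda>x. enn2real (W x))"
  have [measurable]: "w \<in> borel_measurable borel" unfolding w_def by measurable
  have int_w: "(w has_integral F b - F a) {a..b}" if ab: "a \<le> b" for a b
  proof -
    have "(\<integral>\<^sup>+x. ennreal (w x * indicator {a..b} x) \<partial>lborel) = (\<integral>\<^sup>+x. W x * indicator {a..b} x \<partial>lborel)"
      by (rule nn_integral_cong_AE) (use fin in \<open>auto simp: w_def indicator_def ennreal_enn2real_if\<close>)
    also have "\<dots> = ennreal (F b - F a)" using em_Icc[OF ab] emW[of "{a..b}"] by simp
    finally have "((\<lambda>x. w x * indicator {a..b} x) has_integral F b - F a) UNIV"
      using ab by (intro nn_integral_has_integral) (auto simp: w_def le_iff)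
    moreover have "(\<lambda>x. w x * indicator {a..b} x) = (\<lambda>x. if x \<in> {a..b} then w x else 0)" by auto
    ultimately show ?thesis by (metis has_integral_restrict_UNIV)
  qed
  \<comment> \<open>\<open>P Q x\<close>: quotients at \<open>x\<close> with property
    \<open>Q\<close> occur arbitrarily close to \<open>x\<close>. So \<open>E1\<close> collects the
    points where the density is below \<open>p\<close> but quotients above \<open>q\<close> recur,
    and \<open>E2\<close> those where the density is above \<open>q\<close> but quotients below
    \<open>p\<close> recur.\<close>
  define P where "P = (\<lambda>Q x. \<forall>d>0. \<exists>y. y \<noteq> x \<and> \<bar>y - x\<bar> < d \<and> Q ((F y - F x) / (y - x)))"
  have notP: "\<exists>d>0. \<forall>y. y \<noteq> x \<longrightarrow> \<bar>y - x\<bar> < d \<longrightarrow> \<not> Q ((F y - F x) / (y - x))"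
    if "\<not> P Q x" for Q x
    using that unfolding P_def by auto
  define E1 where "E1 = (\<lambda>p q. {x. W x < ennreal p \<and> P (\<lambda>z. q < z) x})"
  define E2 where "E2 = (\<lambda>p q. {x. ennreal q < W x \<and> P (\<lambda>z. z < p) x})"
  \<comment> \<open>The symmetry of the difference quotient replaces an approach from either side by
    an interval that has \<open>x\<close> as an endpoint, as the Vitali family requires.\<close>
  have P: "\<exists>s t. s < t \<and> x \<in> {s..t} \<and> t - s < d \<and> Q ((F t - F s) / (t - s))"
    if "P Q x" "d > 0" for Q x d
  proof -
    obtain y where y: "y \<noteq> x" "\<bar>y - x\<bar> < d" "Q ((F y - F x) / (y - x))"
      using \<open>P Q x\<close> \<open>d > 0\<close> by (auto simp: P_def)
    moreover have "(F y - F x) / (y - x) = (F x - F y) / (x - y)"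
      by (metis minus_diff_eq minus_divide_divide)
    ultimately have y': "Q ((F x - F y) / (x - y))" by metis
    show ?thesis
    proof (cases "x < y")
      case True
      with y show ?thesis by (intro exI[of _ x] exI[of _ y]) simp
    next
      case False
      with y y' show ?thesis by (intro exI[of _ y] exI[of _ x]) simp
    qed
  qed
  \<comment> \<open>On the Vitali set \<open>B\<close>, \<mu> is at least \<open>q\<close> times
    Lebesgue measure. It is also at most \<open>p\<close> times Lebesgue measure plus
    \<open>e\<close>, since the density is below \<open>p\<close> on \<open>A\<close> and \<mu> of
    \<open>U - A\<close> is at most \<open>e\<close>. Hence \<open>(q - p) * b \<le> e\<close>. The
    bounded window \<open>J\<close> keeps these measures finite.\<close>
  have neg1: "negligible (E1 p q)" if pq: "0 \<le> p" "p < q" for p q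
  proof (subst negligible_on_intervals, intro allI)
    fix c d :: real
    define J where "J = {c - 1<..<d + 1}"
    define A where "A = {x \<in> J. W x < ennreal p}"
    have [measurable]: "J \<in> sets borel" unfolding J_def by measurable
    have [measurable]: "A \<in> sets borel" unfolding A_def by measurable
    have "negligible (E1 p q \<inter> J)"
    proof (rule negligible_outer_borel[of "ennreal (1 / (q - p))"])
      fix e :: real assume e: "e > 0"
      obtain V where V: "open V" "F ` A \<subseteq> V" "V - F ` A \<in> lmeasurable" "emeasure lebesgue (V - F ` A) < e"
        using sets_lebesgue_outer_open[of "F ` A" e] borel_img[of A] e by auto
      define U where "U = F -` V \<inter> J"
      have oU: "open U" unfolding U_def J_def
        by (intro open_Int open_vimage V(1) cont open_greaterThanLessThan)
      have EU: "E1 p q \<inter> J \<subseteq> U" using V(2) by (auto simp: E1_def U_def A_def)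
      have fine: "\<exists>s t. s < t \<and> x \<in> {s..t} \<and> t - s < d \<and>
          emeasure (scale_measure (ennreal q) lborel) {s..t} \<le> emeasure \<mu> {s..t}"
        if xd: "x \<in> E1 p q \<inter> J" "d > 0" for x d :: real
      proof -
        obtain s t where st: "s < t" "x \<in> {s..t}" "t - s < d" "q < (F t - F s) / (t - s)"
          using P[of "\<lambda>z. q < z", OF _ xd(2)] xd(1) unfolding E1_def by blast
        then have "q * (t - s) \<le> F t - F s" by (simp add: field_simps)
        then show ?thesis
          using st pq by (intro exI[of _ s] exI[of _ t]) (auto simp: em_Icc ennreal_mult[symmetric] intro!: ennreal_leI)
      qed
      obtain B where B: "B \<in> sets borel" "B \<subseteq> U" "negligible (E1 p q \<inter> J - B)"
        "emeasure (scale_measure (ennreal q) lborel) B \<le> emeasure \<mu> B"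
        by (rule Vitali_measure_comparison[OF _ _ EU oU fine]) (assumption | simp)+
      have "emeasure lborel B \<le> emeasure lborel J"
        using B by (intro emeasure_mono) (auto simp: U_def)
      also have "\<dots> < \<infinity>"
        by (rule emeasure_bounded_finite) (simp add: J_def flip: box_real)
      finally obtain b where b: "emeasure lborel B = ennreal b" "b \<ge> 0"
        by (cases "emeasure lborel B") auto
      have "emeasure \<mu> B = emeasure \<mu> (B \<inter> A) + emeasure \<mu> (B - A)"
        using B(1) by (subst plus_emeasure) (auto simp: Int_Diff_Un)
      also have "emeasure \<mu> (B \<inter> A) \<le> (\<integral>\<^sup>+x. ennreal p * indicator (B \<inter> A) x \<partial>lborel)"
        using B(1) by (subst emW) (auto intro!: nn_integral_mono simp: A_def indicator_def)
      also have "\<dots> = ennreal p * emeasure lborel (B \<inter> A)"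
        using B(1) by (subst nn_integral_cmult_indicator) auto
      also have "\<dots> \<le> ennreal p * emeasure lborel B"
        using B(1) by (intro mult_left_mono emeasure_mono) auto
      also have "emeasure \<mu> (B - A) = emeasure lborel (F ` (B - A))"
        using B(1) by (simp add: em)
      also have "\<dots> = emeasure lebesgue (F ` (B - A))"
        using B(1) borel_img[of "B - A"] by simp
      also have "\<dots> \<le> emeasure lebesgue (V - F ` A)"
        using B(2) V(3) by (intro emeasure_mono) (auto simp: U_def le_iff dest: injD[OF inj])
      also have "\<dots> \<le> ennreal e" using V(4) by simp
      finally have "emeasure \<mu> B \<le> ennreal p * ennreal b + ennreal e"
        unfolding b by (auto simp: add_mono)
      with B(4) have "ennreal q * ennreal b \<le> ennreal p * ennreal b + ennreal e"
        by (simp add: b)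
      then have "ennreal (q * b) \<le> ennreal (p * b + e)"
        using pq b e by (simp add: ennreal_mult)
      then have "q * b \<le> p * b + e" using pq b e by (subst (asm) ennreal_le_iff) auto
      then have "b \<le> 1 / (q - p) * e" using pq by (simp add: field_simps)
      then have "emeasure lborel B \<le> ennreal (1 / (q - p)) * ennreal e"
        using pq e unfolding b by (subst ennreal_mult[symmetric]) (auto intro!: ennreal_leI)
      with B show "\<exists>B \<in> sets borel. negligible (E1 p q \<inter> J - B) \<and> emeasure lborel B \<le> ennreal (1 / (q - p)) * ennreal e"
        by blast
    qed auto
    then show "negligible (E1 p q \<inter> cbox c d)"
      by (rule negligible_subset) (auto simp: J_def)
  qed
  \<comment> \<open>The inequalities are reversed: \<open>q\<close> times the length of
    \<open>B \<inter> A\<close> is at most \<mu> of \<open>B\<close>, hence at most \<open>p\<close>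
    times the length of \<open>B\<close>, while \<open>B - A\<close> has length at most
    \<open>e\<close>. Now the Lebesgue excess matters, so regularity is applied to \<open>A\<close>
    itself.\<close>
  have neg2: "negligible (E2 p q)" if pq: "0 \<le> p" "p < q" for p q
  proof (subst negligible_on_intervals, intro allI)
    fix c d :: real
    define J where "J = {c - 1<..<d + 1}"
    define A where "A = {x \<in> J. ennreal q < W x}"
    have [measurable]: "J \<in> sets borel" unfolding J_def by measurable
    have [measurable]: "A \<in> sets borel" unfolding A_def by measurable
    have "negligible (E2 p q \<inter> J)"
    proof (rule negligible_outer_borel[of "ennreal (q / (q - p))"])
      fix e :: real assume e: "e > 0"
      obtain V where V: "open V" "A \<subseteq> V" "V - A \<in> lmeasurable" "emeasure lebesgue (V - A) < e"
        using sets_lebesgue_outer_open[of "A" e] e by auto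
      define U where "U = V \<inter> J"
      have oU: "open U" unfolding U_def J_def using V(1) by auto
      have EU: "E2 p q \<inter> J \<subseteq> U" using V(2) by (auto simp: E2_def U_def A_def)
      have fine: "\<exists>s t. s < t \<and> x \<in> {s..t} \<and> t - s < d \<and>
          emeasure \<mu> {s..t} \<le> emeasure (scale_measure (ennreal p) lborel) {s..t}"
        if xd: "x \<in> E2 p q \<inter> J" "d > 0" for x d :: real
      proof -
        obtain s t where st: "s < t" "x \<in> {s..t}" "t - s < d" "(F t - F s) / (t - s) < p"
          using P[of "\<lambda>z. z < p", OF _ xd(2)] xd(1) unfolding E2_def by blast
        then have "F t - F s \<le> p * (t - s)" by (simp add: field_simps)
        then show ?thesis
          using st pq by (intro exI[of _ s] exI[of _ t]) (auto simp: em_Icc ennreal_mult[symmetric] intro!: ennreal_leI)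
      qed
      obtain B where B: "B \<in> sets borel" "B \<subseteq> U" "negligible (E2 p q \<inter> J - B)"
        "emeasure \<mu> B \<le> emeasure (scale_measure (ennreal p) lborel) B"
        by (rule Vitali_measure_comparison[OF _ _ EU oU fine]) (assumption | simp)+
      have "emeasure lborel B \<le> emeasure lborel J"
        using B by (intro emeasure_mono) (auto simp: U_def)
      also have "\<dots> < \<infinity>"
        by (rule emeasure_bounded_finite) (simp add: J_def flip: box_real)
      finally have fB: "emeasure lborel B < \<infinity>" .
      have split: "emeasure lborel B = emeasure lborel (B \<inter> A) + emeasure lborel (B - A)"
        using B(1) by (subst plus_emeasure) (auto simp: Int_Diff_Un)
      obtain b1 where b1: "emeasure lborel (B \<inter> A) = ennreal b1" "b1 \<ge> 0"
        using fB split by (cases "emeasure lborel (B \<inter> A)") auto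
      have "emeasure lborel (B - A) = emeasure lebesgue (B - A)" using B(1) by simp
      also have "\<dots> \<le> emeasure lebesgue (V - A)"
        using B(2) V(3) by (intro emeasure_mono) (auto simp: U_def)
      also have "\<dots> \<le> ennreal e" using V(4) by simp
      finally obtain b2 where b2: "emeasure lborel (B - A) = ennreal b2" "b2 \<ge> 0" "b2 \<le> e"
        using e by (cases "emeasure lborel (B - A)") (auto simp: top_unique)
      have "ennreal q * emeasure lborel (B \<inter> A) = (\<integral>\<^sup>+x. ennreal q * indicator (B \<inter> A) x \<partial>lborel)"
        using B(1) by (subst nn_integral_cmult_indicator) auto
      also have "\<dots> \<le> emeasure \<mu> (B \<inter> A)"
        using B(1) by (subst emW) (auto intro!: nn_integral_mono simp: A_def indicator_def)
      also have "\<dots> \<le> emeasure \<mu> B"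
        using B(1) by (intro emeasure_mono) auto
      also have "\<dots> \<le> ennreal p * emeasure lborel B" using B(4) by simp
      finally have "ennreal (q * b1) \<le> ennreal (p * (b1 + b2))"
        unfolding split b1 b2 using pq b1 b2 by (simp add: ennreal_mult)
      then have "q * b1 \<le> p * (b1 + b2)" using pq b1 b2 by (subst (asm) ennreal_le_iff) auto
      also have "\<dots> \<le> p * (b1 + e)" using pq b2 by (intro mult_left_mono) auto
      finally have "(q - p) * b1 \<le> p * e" by (simp add: algebra_simps)
      moreover have "(q - p) * b2 \<le> (q - p) * e" using pq b2 by (intro mult_left_mono) auto
      ultimately have "(q - p) * (b1 + b2) \<le> q * e" by (simp add: algebra_simps)
      then have "b1 + b2 \<le> q / (q - p) * e" using pq by (simp add: field_simps)
      then have "emeasure lborel B \<le> ennreal (q / (q - p)) * ennreal e"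
        using pq e b1 b2 unfolding split b1 b2
        by (subst ennreal_mult[symmetric]) (auto simp flip: ennreal_plus intro!: ennreal_leI)
      with B show "\<exists>B \<in> sets borel. negligible (E2 p q \<inter> J - B) \<and> emeasure lborel B \<le> ennreal (q / (q - p)) * ennreal e"
        by blast
    qed auto
    then show "negligible (E2 p q \<inter> cbox c d)"
      by (rule negligible_subset) (auto simp: J_def)
  qed
  define I where "I = {(p, q) \<in> \<rat> \<times> \<rat>. 0 \<le> p \<and> p < (q::real)}"
  \<comment> \<open>Rational pairs suffice to separate the density from a recurring quotient, which
    leaves a countable union of null sets.\<close>
  define N where "N = (\<Union>(p, q) \<in> I. E1 p q \<union> E2 p q) \<union> {x. W x = \<infinity>}"
  have "countable I"
    by (rule countable_subset[of _ "\<rat> \<times> \<rat>"]) (auto simp: I_def countable_rat)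
  then have "negligible (\<Union>(p, q) \<in> I. E1 p q \<union> E2 p q)"
    by (intro negligible_countable_Union) (auto simp: I_def intro!: neg1 neg2)
  moreover have "negligible {x. W x = \<infinity>}"
    using fin by (auto simp: negligible_iff_null_sets AE_iff_null_sets intro!: AE_completion)
  ultimately have "negligible N" unfolding N_def by (rule negligible_Un)
  moreover have "(F has_real_derivative w x) (at x)" if x: "x \<notin> N" for x
    unfolding has_field_derivative_iff LIM_eq
  proof (intro allI impI)
    fix e :: real assume e: "e > 0"
    have Wx: "W x = ennreal (w x)" using x by (auto simp: N_def w_def ennreal_enn2real_if)
    have w0: "0 \<le> w x" by (simp add: w_def)
    have quot: "0 \<le> (F y - F x) / (y - x)" for y
      using le_iff[of x y] le_iff[of y x] by (cases "x \<le> y") (auto intro: divide_nonneg_nonneg divide_nonpos_nonpos)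
    \<comment> \<open>With \<open>w x < p1 < q1 < w x + e\<close>, membership in
      \<open>E1 p1 q1\<close> is excluded, so all quotients close to \<open>x\<close> are at most
      \<open>q1\<close>. The pair \<open>p2 < q2\<close> below \<open>w x\<close> gives the lower
      bound.\<close>
    obtain p1 where p1: "p1 \<in> \<rat>" "w x < p1" "p1 < w x + e" using Rats_dense_in_real[of "w x" "w x + e"] e by auto
    obtain q1 where q1: "q1 \<in> \<rat>" "p1 < q1" "q1 < w x + e" using Rats_dense_in_real[of p1 "w x + e"] p1 by auto
    have "x \<notin> E1 p1 q1" using x p1 q1 w0 by (auto simp: N_def I_def)
    moreover have "W x < ennreal p1" using Wx p1 w0 by (simp add: ennreal_less_iff)
    ultimately have "\<exists>d>0. \<forall>y. y \<noteq> x \<longrightarrow> \<bar>y - x\<bar> < d \<longrightarrow> (F y - F x) / (y - x) \<le> q1"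
      using notP[of "\<lambda>z. q1 < z" x] by (simp add: E1_def not_less)
    then obtain d1 where d1: "d1 > 0" "\<And>y. y \<noteq> x \<Longrightarrow> \<bar>y - x\<bar> < d1 \<Longrightarrow> (F y - F x) / (y - x) \<le> q1"
      by blast
    obtain q2 where q2: "q2 \<in> \<rat>" "w x - e < q2" "q2 < w x" using Rats_dense_in_real[of "w x - e" "w x"] e by auto
    obtain p2 where p2: "p2 \<in> \<rat>" "w x - e < p2" "p2 < q2" using Rats_dense_in_real[of "w x - e" q2] q2 by auto
    obtain d2 where d2: "d2 > 0" "\<And>y. y \<noteq> x \<Longrightarrow> \<bar>y - x\<bar> < d2 \<Longrightarrow> p2 \<le> (F y - F x) / (y - x)"
    proof (cases "p2 \<ge> 0")
      case True
      have "x \<notin> E2 p2 q2" using x p2 q2 True by (auto simp: N_def I_def)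
      moreover have "ennreal q2 < W x" using Wx p2 q2 True by (simp add: ennreal_less_iff)
      ultimately have "\<exists>d>0. \<forall>y. y \<noteq> x \<longrightarrow> \<bar>y - x\<bar> < d \<longrightarrow> p2 \<le> (F y - F x) / (y - x)"
        using notP[of "\<lambda>z. z < p2" x] by (simp add: E2_def not_less)
      then show ?thesis using that by blast
    next
      \<comment> \<open>A negative \<open>p2\<close> is not covered by \<open>E2\<close>, but then
        the bound is automatic because quotients of the increasing \<open>F\<close> are
        nonnegative.\<close>
      case False
      then show ?thesis using that[of 1] quot by (smt (verit))
    qed
    show "\<exists>d>0. \<forall>y. y \<noteq> x \<and> norm (y - x) < d \<longrightarrow> norm ((F y - F x) / (y - x) - w x) < e"
    proof (intro exI[of _ "min d1 d2"] conjI allI impI)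
      fix y assume "y \<noteq> x \<and> norm (y - x) < min d1 d2"
      then show "norm ((F y - F x) / (y - x) - w x) < e"
        using d1(2)[of y] d2(2)[of y] q1 p2 by (auto simp: abs_less_iff)
    qed (use d1 d2 in auto)
  qed
  ultimately show ?thesis using int_w that by blast
qed

text \<open>Adding \<open>(L + 1) * x\<close> turns an \<open>L\<close>-Lipschitz function into one
  with slopes between \<open>1\<close> and \<open>2 * L + 1\<close>. The clamp \<open>c\<close>
  extends \<open>h\<close> constantly beyond the interval, so that the result on the whole line
  applies; the linear term is subtracted at the end.\<close>

lemma lipschitz_ae_derivative_real:
  fixes h :: "real \<Rightarrow> real"
  assumes h: "L-lipschitz_on {a..b} h"
  obtains g N where "negligible N"
    "\<And>x. x \<in> {a..b} - N \<Longrightarrow> (h has_vector_derivative g x) (at x within {a..b})"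
    "\<And>s t. a \<le> s \<Longrightarrow> s \<le> t \<Longrightarrow> t \<le> b \<Longrightarrow> (g has_integral h t - h s) {s..t}"
proof (cases "a \<le> b")
  case True
  define c where "c = (\<lambda>x. max a (min b x))"
  define F where "F = (\<lambda>x. h (c x) + (L + 1) * x)"
  have L: "L \<ge> 0" using h by (rule lipschitz_on_nonneg)
  have hc: "\<bar>h (c y) - h (c x)\<bar> \<le> L * (y - x)" if "x \<le> y" for x y
  proof -
    have "\<bar>h (c y) - h (c x)\<bar> \<le> L * \<bar>c y - c x\<bar>"
      using lipschitz_onD[OF h, of "c y" "c x"] True by (auto simp: c_def dist_real_def)
    also have "\<dots> \<le> L * (y - x)"
      using that L by (intro mult_left_mono) (auto simp: c_def)
    finally show ?thesis .
  qed
  have 1: "y - x \<le> F y - F x" and 2: "F y - F x \<le> (2 * L + 1) * (y - x)" if "x \<le> y" for x y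
    using hc[OF that] by (auto simp: F_def abs_le_iff algebra_simps)
  obtain w N where wN: "negligible N" "\<And>x. x \<notin> N \<Longrightarrow> (F has_real_derivative w x) (at x)"
    "\<And>a b. a \<le> b \<Longrightarrow> (w has_integral F b - F a) {a..b}"
    by (rule bilipschitz_ae_derivative[of F "2 * L + 1", OF 1 2]) (assumption+, (rule that; assumption))
  have F: "F x = h x + (L + 1) * x" if "x \<in> {a..b}" for x
    using that by (simp add: F_def c_def)
  show ?thesis
  proof
    show "negligible N" by fact
    fix x assume x: "x \<in> {a..b} - N"
    have "((\<lambda>x. F x - (L + 1) * x) has_real_derivative w x - (L + 1)) (at x within {a..b})"
      using x wN(2) by (auto intro!: derivative_eq_intros dest: has_field_derivative_at_within)
    then have "(h has_real_derivative w x - (L + 1)) (at x within {a..b})"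
      by (rule has_field_derivative_transform_within[where d=1]) (use x F in auto)
    then show "(h has_vector_derivative w x - (L + 1)) (at x within {a..b})"
      by (simp add: has_real_derivative_iff_has_vector_derivative)
  next
    fix s t assume st: "a \<le> s" "s \<le> t" "t \<le> b"
    have "((\<lambda>x. L + 1) has_integral (t - s) *\<^sub>R (L + 1)) {s..t}"
      using has_integral_const_real[of "L + 1" s t] st by simp
    then have "((\<lambda>x. w x - (L + 1)) has_integral (F t - F s) - (t - s) *\<^sub>R (L + 1)) {s..t}"
      by (intro has_integral_diff wN(3) st)
    then show "((\<lambda>x. w x - (L + 1)) has_integral h t - h s) {s..t}"
      using st by (simp add: F algebra_simps)
  qed
qed (use that[of "{}"] in auto)

text \<open>The real case is applied to each coordinate; the finitely many null sets are
  united.\<close>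

lemma lipschitz_ae_vector_derivative:
  fixes h :: "real \<Rightarrow> 'a::euclidean_space"
  assumes h: "L-lipschitz_on {a..b} h"
  obtains g N where "negligible N"
    "\<And>x. x \<in> {a..b} - N \<Longrightarrow> (h has_vector_derivative g x) (at x within {a..b})"
    "\<And>s t. a \<le> s \<Longrightarrow> s \<le> t \<Longrightarrow> t \<le> b \<Longrightarrow> (g has_integral h t - h s) {s..t}"
proof -
  have "\<exists>g N. negligible N \<and>
      (\<forall>x \<in> {a..b} - N. ((\<lambda>x. h x \<bullet> i) has_vector_derivative g x) (at x within {a..b})) \<and>
      (\<forall>s t. a \<le> s \<longrightarrow> s \<le> t \<longrightarrow> t \<le> b \<longrightarrow> (g has_integral h t \<bullet> i - h s \<bullet> i) {s..t})"
    if i: "i \<in> Basis" for i :: 'a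
  proof -
    have "L-lipschitz_on {a..b} (\<lambda>x. h x \<bullet> i)"
    proof (rule lipschitz_onI)
      fix x y assume "x \<in> {a..b}" "y \<in> {a..b}"
      then have "norm (h x - h y) \<le> L * dist x y"
        using lipschitz_onD[OF h] by (simp add: dist_norm)
      then show "dist (h x \<bullet> i) (h y \<bullet> i) \<le> L * dist x y"
        using Basis_le_norm[OF i, of "h x - h y"] by (simp add: dist_real_def inner_diff_left)
    qed (use h lipschitz_on_nonneg in blast)
    then show ?thesis by (rule lipschitz_ae_derivative_real) blast
  qed
  then obtain g N where gN: "\<And>i. i \<in> Basis \<Longrightarrow> negligible (N i)"
    "\<And>i x. i \<in> Basis \<Longrightarrow> x \<in> {a..b} - N i \<Longrightarrow>
      ((\<lambda>x. h x \<bullet> i) has_vector_derivative g i x) (at x within {a..b})"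
    "\<And>i s t. i \<in> Basis \<Longrightarrow> a \<le> s \<Longrightarrow> s \<le> t \<Longrightarrow> t \<le> b \<Longrightarrow> (g i has_integral h t \<bullet> i - h s \<bullet> i) {s..t}"
    by metis
  show ?thesis
  proof
    show "negligible (\<Union>i\<in>Basis. N i)"
      by (intro negligible_Union) (auto intro: gN)
    fix x assume x: "x \<in> {a..b} - (\<Union>i\<in>Basis. N i)"
    have "((\<lambda>x. \<Sum>i\<in>Basis. (h x \<bullet> i) *\<^sub>R i) has_vector_derivative (\<Sum>i\<in>Basis. g i x *\<^sub>R i)) (at x within {a..b})"
    proof (intro has_vector_derivative_sum)
      fix i :: 'a assume i: "i \<in> Basis"
      show "((\<lambda>x. (h x \<bullet> i) *\<^sub>R i) has_vector_derivative g i x *\<^sub>R i) (at x within {a..b})"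
        using bounded_linear.has_vector_derivative[OF bounded_linear_scaleR_left gN(2)[OF i]] x i
        by auto
    qed
    then show "(h has_vector_derivative (\<Sum>i\<in>Basis. g i x *\<^sub>R i)) (at x within {a..b})"
      by (simp add: euclidean_representation)
  next
    fix s t assume st: "a \<le> s" "s \<le> t" "t \<le> b"
    have "((\<lambda>x. \<Sum>i\<in>Basis. g i x *\<^sub>R i) has_integral (\<Sum>i\<in>Basis. (h t \<bullet> i - h s \<bullet> i) *\<^sub>R i)) {s..t}"
      by (intro has_integral_sum has_integral_scaleR_left gN st) auto
    also have "(\<Sum>i\<in>Basis. (h t \<bullet> i - h s \<bullet> i) *\<^sub>R i) = h t - h s"
      by (simp add: inner_diff_left[symmetric] euclidean_representation)
    finally show "((\<lambda>x. \<Sum>i\<in>Basis. g i x *\<^sub>R i) has_integral h t - h s) {s..t}" .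
  qed
qed

text \<open>Derivatives within a nondegenerate interval are unique, so any almost everywhere
  derivative agrees almost everywhere with the one already known to integrate back to
  \<open>h\<close>.\<close>

lemma has_integral_lipschitz_derivative:
  fixes h :: "real \<Rightarrow> 'a::euclidean_space"
  assumes h: "L-lipschitz_on {a..b} h" and N: "negligible N"
    and g: "\<And>x. x \<in> {a..b} - N \<Longrightarrow> (h has_vector_derivative g x) (at x within {a..b})"
    and st: "a \<le> s" "s \<le> t" "t \<le> b"
  shows "(g has_integral h t - h s) {s..t}"
proof (cases "a < b")
  case True
  obtain g' N' where gN: "negligible N'"
    "\<And>x. x \<in> {a..b} - N' \<Longrightarrow> (h has_vector_derivative g' x) (at x within {a..b})"
    "\<And>s t. a \<le> s \<Longrightarrow> s \<le> t \<Longrightarrow> t \<le> b \<Longrightarrow> (g' has_integral h t - h s) {s..t}"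
    by (rule lipschitz_ae_vector_derivative[OF h]) (rule that; assumption)
  show ?thesis
  proof (rule has_integral_spike[OF _ _ gN(3)[OF st]])
    show "negligible (N \<union> N')" using N gN by auto
    fix x assume "x \<in> {s..t} - (N \<union> N')"
    then show "g x = g' x"
      using True st g[of x] gN(2)[of x]
        vector_derivative_unique_within_closed_interval[of a b x h "g x" "g' x"] by auto
  qed
next
  case False
  then have "s = t" using st by auto
  then show ?thesis by (auto intro: has_integral_refl)
qed

section \<open>Lipschitz estimates, absolute continuity and difference quotients\<close>

lemma lipschitz_on_vector_derivative_bound:
  fixes h :: "real \<Rightarrow> 'a::real_normed_vector"
  assumes h: "L-lipschitz_on {a..b} h" and ab: "a < b" "x \<in> {a..b}"
    and v: "(h has_vector_derivative v) (at x within {a..b})"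
  shows "norm v \<le> L"
proof -
  have "((\<lambda>y. norm ((h y - h x) - (y - x) *\<^sub>R v) / norm (y - x)) \<longlongrightarrow> 0) (at x within {a..b})"
    using v by (simp add: has_vector_derivative_def has_derivative_iff_norm)
  \<comment> \<open>By the triangle inequality the constant \<open>norm v - L\<close> bounds from
    below a quantity that tends to zero.\<close>
  moreover have "\<forall>\<^sub>F y in at x within {a..b}. norm v - L \<le> norm ((h y - h x) - (y - x) *\<^sub>R v) / norm (y - x)"
    unfolding eventually_at_filter
  proof (intro always_eventually allI impI)
    fix y assume y: "y \<noteq> x" "y \<in> {a..b}"
    have "\<bar>y - x\<bar> * norm v = norm ((h y - h x) - ((h y - h x) - (y - x) *\<^sub>R v))" by simp
    also have "\<dots> \<le> norm (h y - h x) + norm ((h y - h x) - (y - x) *\<^sub>R v)"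
      by (rule norm_triangle_ineq4)
    also have "norm (h y - h x) \<le> L * \<bar>y - x\<bar>"
      using lipschitz_onD[OF h, of y x] ab y by (simp add: dist_norm)
    finally show "norm v - L \<le> norm ((h y - h x) - (y - x) *\<^sub>R v) / norm (y - x)"
      using y by (simp add: field_simps)
  qed
  moreover have "at x within {a..b} \<noteq> bot"
    using ab by (simp add: trivial_limit_within islimpt_Icc)
  ultimately have "norm v - L \<le> 0" by (rule tendsto_lowerbound)
  then show ?thesis by simp
qed

text \<open>The fundamental theorem of calculus tolerates finitely many points without a derivative
  if \<open>h\<close> is continuous there. This covers a difference quotient at the node where it is
  extended only continuously.\<close>

lemma lipschitz_on_finite_exceptional_derivative:
  fixes h :: "real \<Rightarrow> 'a::euclidean_space"
  assumes S: "finite S" and cont: "continuous_on {a..b} h"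
    and h: "\<And>x. x \<in> {a..b} - S \<Longrightarrow> (h has_vector_derivative g x) (at x within {a..b})"
    and B: "\<And>x. x \<in> {a..b} - S \<Longrightarrow> norm (g x) \<le> B" and B0: "0 \<le> B"
  shows "B-lipschitz_on {a..b} h"
proof (rule lipschitz_on_leI[OF _ B0])
  fix s t assume st: "s \<in> {a..b}" "t \<in> {a..b}" "s \<le> t"
  have "(g has_integral h t - h s) {s..t}"
  proof (rule fundamental_theorem_of_calculus_interior_strong[OF S st(3)])
    fix x assume x: "x \<in> {s<..<t} - S"
    then have "(h has_vector_derivative g x) (at x within {s<..<t})"
      using st by (intro has_vector_derivative_within_subset[OF h[of x]]) auto
    moreover have "at x within {s<..<t} = at x"
      by (rule at_within_open) (use x in auto)
    ultimately show "(h has_vector_derivative g x) (at x)" by simp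
  next
    show "continuous_on {s..t} h"
      by (rule continuous_on_subset[OF cont]) (use st in auto)
  qed
  then have "norm (h t - h s) \<le> B * measure lborel {s..t}"
    using st by (intro has_integral_bound_real[OF B0 S]) (auto intro: B)
  then show "dist (h s) (h t) \<le> B * dist s t"
    using st by (simp add: dist_norm norm_minus_commute)
qed

lemma lipschitz_on_mult_bounded:
  fixes f g :: "'a::metric_space \<Rightarrow> 'b::real_normed_algebra"
  assumes f: "L-lipschitz_on X f" and g: "M-lipschitz_on X g"
    and A: "\<And>x. x \<in> X \<Longrightarrow> norm (f x) \<le> A" and B: "\<And>x. x \<in> X \<Longrightarrow> norm (g x) \<le> B"
    and AB: "0 \<le> A" "0 \<le> B"
  shows "(A * M + L * B)-lipschitz_on X (\<lambda>x. f x * g x)"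
proof (rule lipschitz_onI)
  fix x y assume xy: "x \<in> X" "y \<in> X"
  have "norm (f x * g x - f y * g y) = norm (f x * (g x - g y) + (f x - f y) * g y)"
    by (simp add: algebra_simps)
  also have "\<dots> \<le> norm (f x) * norm (g x - g y) + norm (f x - f y) * norm (g y)"
    by (intro norm_triangle_le add_mono norm_mult_ineq)
  also have "\<dots> \<le> A * (M * dist x y) + (L * dist x y) * B"
    using lipschitz_onD[OF f xy] lipschitz_onD[OF g xy] A B xy AB lipschitz_on_nonneg[OF f]
    by (intro add_mono mult_mono) (auto simp: dist_norm)
  finally show "dist (f x * g x) (f y * g y) \<le> (A * M + L * B) * dist x y"
    by (simp add: dist_norm algebra_simps)
qed (use AB f g lipschitz_on_nonneg in \<open>blast intro: add_nonneg_nonneg mult_nonneg_nonneg\<close>)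

lemma lipschitz_on_mult_compact:
  fixes f g :: "'a::metric_space \<Rightarrow> 'b::real_normed_algebra"
  assumes X: "compact X" and f: "L-lipschitz_on X f" and g: "M-lipschitz_on X g"
  shows "\<exists>K. K-lipschitz_on X (\<lambda>x. f x * g x)"
proof -
  have "bounded (f ` X)" "bounded (g ` X)"
    using X f g by (auto intro!: compact_imp_bounded compact_continuous_image lipschitz_on_continuous_on)
  then obtain A B where "A > 0" "\<And>x. x \<in> X \<Longrightarrow> norm (f x) \<le> A" "B > 0" "\<And>x. x \<in> X \<Longrightarrow> norm (g x) \<le> B"
    unfolding bounded_pos by auto
  with lipschitz_on_mult_bounded[OF f g, of A B] show ?thesis by (auto simp: less_imp_le)
qed

lemma lipschitz_imp_absolutely_continuous_on:
  assumes h: "L-lipschitz_on {a..b} h"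
  shows "absolutely_continuous_on a b h"
  unfolding absolutely_continuous_on_def
proof (intro allI impI)
  fix e :: real assume e: "e > 0"
  have L: "L \<ge> 0" using h by (rule lipschitz_on_nonneg)
  show "\<exists>d>0. \<forall>(N::nat) u v. (\<forall>i<N. a \<le> u i \<and> u i \<le> v i \<and> v i \<le> b) \<and>
      (\<forall>i<N. \<forall>j<N. i \<noteq> j \<longrightarrow> v i \<le> u j \<or> v j \<le> u i) \<and> (\<Sum>i<N. v i - u i) < d \<longrightarrow>
      (\<Sum>i<N. norm (h (v i) - h (u i))) < e"
  \<comment> \<open>Dividing by \<open>L + 1\<close> instead of \<open>L\<close> keeps the choice
    positive and meaningful when \<open>L\<close> is zero.\<close>
  proof (rule exI[of _ "e / (L + 1)"], intro conjI allI impI)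
    show "0 < e / (L + 1)" using e L by simp
  next
    fix N :: nat and u v :: "nat \<Rightarrow> real"
    assume "(\<forall>i<N. a \<le> u i \<and> u i \<le> v i \<and> v i \<le> b) \<and>
      (\<forall>i<N. \<forall>j<N. i \<noteq> j \<longrightarrow> v i \<le> u j \<or> v j \<le> u i) \<and> (\<Sum>i<N. v i - u i) < e / (L + 1)"
    then have uv: "\<forall>i<N. a \<le> u i \<and> u i \<le> v i \<and> v i \<le> b" and s: "(\<Sum>i<N. v i - u i) < e / (L + 1)"
      by auto
    have "(\<Sum>i<N. norm (h (v i) - h (u i))) \<le> (\<Sum>i<N. L * (v i - u i))"
    proof (rule sum_mono)
      fix i assume "i \<in> {..<N}"
      with uv have "u i \<in> {a..b}" "v i \<in> {a..b}" "u i \<le> v i" by (force dest: spec[of _ i])+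
      then show "norm (h (v i) - h (u i)) \<le> L * (v i - u i)"
        using lipschitz_onD[OF h, of "v i" "u i"] by (simp add: dist_norm)
    qed
    also have "\<dots> \<le> (L + 1) * (\<Sum>i<N. v i - u i)"
      using uv by (auto simp: sum_distrib_left[symmetric] distrib_right intro!: sum_nonneg)
    also have "\<dots> < e" using s L by (simp add: field_simps)
    finally show "(\<Sum>i<N. norm (h (v i) - h (u i))) < e" .
  qed
qed

lemma has_vector_derivative_imp_tendsto_quotient:
  assumes "(h has_vector_derivative v) (at x within S)"
  shows "((\<lambda>y. (h y - h x) /\<^sub>R (y - x)) \<longlongrightarrow> v) (at x within S)"
proof -
  have "((\<lambda>y. norm ((h y - h x) - (y - x) *\<^sub>R v) / norm (y - x)) \<longlongrightarrow> 0) (at x within S)"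
    using assms by (simp add: has_vector_derivative_def has_derivative_iff_norm)
  moreover have "\<forall>\<^sub>F y in at x within S. norm ((h y - h x) - (y - x) *\<^sub>R v) / norm (y - x)
      = norm ((h y - h x) /\<^sub>R (y - x) - v)"
    unfolding eventually_at_filter
  proof (intro always_eventually allI impI)
    fix y assume "y \<noteq> x"
    then have "(h y - h x) /\<^sub>R (y - x) - v = ((h y - h x) - (y - x) *\<^sub>R v) /\<^sub>R (y - x)"
      by (simp add: scaleR_right_diff_distrib)
    then show "norm ((h y - h x) - (y - x) *\<^sub>R v) / norm (y - x) = norm ((h y - h x) /\<^sub>R (y - x) - v)"
      by (simp add: divide_inverse_commute)
  qed
  ultimately have "((\<lambda>y. norm ((h y - h x) /\<^sub>R (y - x) - v)) \<longlongrightarrow> 0) (at x within S)"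
    by (rule Lim_transform_eventually)
  then show ?thesis by (rule LIM_zero_cancel[OF tendsto_norm_zero_cancel])
qed

section \<open>Derivatives along a regular arc\<close>

locale regular_arc =
  fixes \<phi> \<phi>' :: "real \<Rightarrow> complex"
  assumes inj: "inj_on \<phi> {0..1}"
    and deriv: "\<And>t. t \<in> {0..1} \<Longrightarrow> (\<phi> has_vector_derivative \<phi>' t) (at t within {0..1})"
    and C1: "continuous_on {0..1} \<phi>'"
    and nonzero: "\<And>t. t \<in> {0..1} \<Longrightarrow> \<phi>' t \<noteq> 0"
begin

definition trace :: "complex set" ("\<gamma>") where "\<gamma> = \<phi> ` {0..1}"

lemma in_trace [simp]: "t \<in> {0..1} \<Longrightarrow> \<phi> t \<in> \<gamma>"
  by (auto simp: trace_def)

lemma trace_cases: assumes "z \<in> \<gamma>" obtains t where "t \<in> {0..1}" "z = \<phi> t"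
  using assms by (auto simp: trace_def)

lemma param_eq_iff: "s \<in> {0..1} \<Longrightarrow> t \<in> {0..1} \<Longrightarrow> \<phi> s = \<phi> t \<longleftrightarrow> s = t"
  using inj by (auto dest: inj_onD)

lemma continuous_param: "continuous_on {0..1} \<phi>"
  unfolding continuous_on_eq_continuous_within
  by (rule ballI, rule has_vector_derivative_continuous, rule deriv)

lemma lipschitz_param: "\<exists>L. L-lipschitz_on {0..1} \<phi>"
proof -
  have "bounded (\<phi>' ` {0..1})"
    by (intro compact_imp_bounded compact_continuous_image C1) simp
  then obtain B where "B > 0" "\<And>t. t \<in> {0..1} \<Longrightarrow> norm (\<phi>' t) \<le> B"
    unfolding bounded_pos by auto
  then have "B-lipschitz_on {0..1} \<phi>"
    by (intro lipschitz_on_finite_exceptional_derivative[of "{}" 0 1 \<phi> \<phi>' B] continuous_param deriv) auto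
  then show ?thesis ..
qed

text \<open>The quotient of chord by parameter difference, completed by the derivative at \<alpha>,
  is continuous. It has no zero, by injectivity and regularity, so its modulus attains a positive
  minimum on the compact interval.\<close>

lemma chord_arc:
  assumes \<alpha>: "\<alpha> \<in> {0..1}"
  obtains c where "c > 0" "\<And>t. t \<in> {0..1} \<Longrightarrow> c * \<bar>t - \<alpha>\<bar> \<le> norm (\<phi> t - \<phi> \<alpha>)"
proof -
  define q where "q = (\<lambda>t. if t = \<alpha> then \<phi>' \<alpha> else (\<phi> t - \<phi> \<alpha>) /\<^sub>R (t - \<alpha>))"
  have lim: "((\<lambda>t. (\<phi> t - \<phi> \<alpha>) /\<^sub>R (t - \<alpha>)) \<longlongrightarrow> \<phi>' \<alpha>) (at \<alpha> within {0..1})"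
    by (rule has_vector_derivative_imp_tendsto_quotient[OF deriv[OF \<alpha>]])
  have "continuous_on {0..1} q"
    unfolding continuous_on_eq_continuous_within
  proof
    fix t :: real assume t: "t \<in> {0..1}"
    show "continuous (at t within {0..1}) q"
    proof (cases "t = \<alpha>")
      case True
      have "(q \<longlongrightarrow> \<phi>' \<alpha>) (at \<alpha> within {0..1})"
        by (rule Lim_transform_eventually[OF lim]) (auto simp: q_def eventually_at_filter)
      then show ?thesis by (simp add: True continuous_within q_def)
    next
      case False
      have "continuous (at t within {0..1}) (\<lambda>t. (\<phi> t - \<phi> \<alpha>) /\<^sub>R (t - \<alpha>))"
        using continuous_param t False
        by (auto intro!: continuous_intros simp: continuous_on_eq_continuous_within)
      then show ?thesis
        by (rule continuous_transform_within[where \<delta> = "\<bar>t - \<alpha>\<bar>"])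
          (use t False in \<open>auto simp: q_def dist_real_def\<close>)
    qed
  qed
  then have "continuous_on {0..1} (\<lambda>t. norm (q t))" by (rule continuous_on_norm)
  then obtain t0 where t0: "t0 \<in> {0..1}" "\<And>t. t \<in> {0..1} \<Longrightarrow> norm (q t0) \<le> norm (q t)"
    using continuous_attains_inf[of "{0..1::real}" "\<lambda>t. norm (q t)"] by auto
  show ?thesis
  proof
    show "norm (q t0) > 0"
      using t0(1) \<alpha> nonzero[OF \<alpha>] by (auto simp: q_def param_eq_iff)
    fix t :: real assume t: "t \<in> {0..1}"
    show "norm (q t0) * \<bar>t - \<alpha>\<bar> \<le> norm (\<phi> t - \<phi> \<alpha>)"
    proof (cases "t = \<alpha>")
      case False
      then show ?thesis using t0(2)[OF t] by (simp add: q_def divide_simps)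
    qed simp
  qed
qed

lemma has_vector_derivative_param:
  assumes t: "t \<in> {0..1}" and G: "(G has_field_derivative D) (at (\<phi> t) within \<gamma>)"
  shows "((\<lambda>s. G (\<phi> s)) has_vector_derivative D * \<phi>' t) (at t within {0..1})"
  using field_vector_diff_chain_within[OF deriv[OF t], of G D] G
  by (simp add: trace_def o_def mult.commute[of D])

text \<open>A continuous injection of a compact interval has a continuous inverse on its image. This
  carries limits in the parameter over to limits along the arc.\<close>

lemma param_inverse:
  obtains \<psi> where "\<And>t. t \<in> {0..1} \<Longrightarrow> \<psi> (\<phi> t) = t" "continuous_on \<gamma> \<psi>"
proof
  show *: "the_inv_into {0..1} \<phi> (\<phi> t) = t" if "t \<in> {0..1}" for t
    using that inj by (simp add: the_inv_into_f_f)
  show "continuous_on \<gamma> (the_inv_into {0..1} \<phi>)"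
    unfolding trace_def by (rule continuous_on_inv[OF continuous_param]) (auto simp: *)
qed

lemma continuous_on_trace:
  assumes "continuous_on {0..1} (\<lambda>t. G (\<phi> t))"
  shows "continuous_on \<gamma> G"
proof -
  obtain \<psi> where \<psi>: "\<And>t. t \<in> {0..1} \<Longrightarrow> \<psi> (\<phi> t) = t" "continuous_on \<gamma> \<psi>"
    using param_inverse by blast
  have "continuous_on \<gamma> (\<lambda>z. G (\<phi> (\<psi> z)))"
    by (rule continuous_on_compose2[OF assms \<psi>(2)]) (auto simp: \<psi>(1) elim!: trace_cases)
  then show ?thesis
    by (rule continuous_on_eq) (auto simp: \<psi>(1) elim!: trace_cases)
qed

text \<open>The quotient along the arc is the quotient of the two parameter quotients, whose
  denominator tends to the nonzero \<open>\<phi>' t\<close>. Composing this limit with the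
  continuous inverse gives the limit along the arc.\<close>

lemma has_field_derivative_from_param:
  assumes t: "t \<in> {0..1}" and v: "((\<lambda>s. G (\<phi> s)) has_vector_derivative v) (at t within {0..1})"
  shows "(G has_field_derivative v / \<phi>' t) (at (\<phi> t) within \<gamma>)"
proof -
  obtain \<psi> where \<psi>: "\<And>t. t \<in> {0..1} \<Longrightarrow> \<psi> (\<phi> t) = t" and cont: "continuous_on \<gamma> \<psi>"
    using param_inverse by blast
  have lim: "((\<lambda>s. ((G (\<phi> s) - G (\<phi> t)) /\<^sub>R (s - t)) / ((\<phi> s - \<phi> t) /\<^sub>R (s - t)))
      \<longlongrightarrow> v / \<phi>' t) (at t within {0..1})"
    by (intro tendsto_divide has_vector_derivative_imp_tendsto_quotient v deriv t nonzero)
  have lim': "((\<lambda>s. (G (\<phi> s) - G (\<phi> t)) / (\<phi> s - \<phi> t)) \<longlongrightarrow> v / \<phi>' t) (at t within {0..1})"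
    by (rule Lim_transform_eventually[OF lim]) (auto simp: eventually_at_filter scaleR_conv_of_real)
  have "filterlim \<psi> (at t within {0..1}) (at (\<phi> t) within \<gamma>)"
    unfolding filterlim_at
  proof
    show "(\<psi> \<longlongrightarrow> t) (at (\<phi> t) within \<gamma>)"
      using cont in_trace[OF t] \<psi>[OF t] unfolding continuous_on_def by fastforce
    \<comment> \<open>Composing punctured limits requires that the inverse avoid \<open>t\<close>
      away from \<open>\<phi> t\<close>, which is injectivity.\<close>
    show "\<forall>\<^sub>F z in at (\<phi> t) within \<gamma>. \<psi> z \<in> {0..1} \<and> \<psi> z \<noteq> t"
      unfolding eventually_at_filter
      by (intro always_eventually) (auto simp: \<psi> elim!: trace_cases)
  qed
  from filterlim_compose[OF lim' this]
  have lim'': "((\<lambda>z. (G (\<phi> (\<psi> z)) - G (\<phi> t)) / (\<phi> (\<psi> z) - \<phi> t)) \<longlongrightarrow> v / \<phi>' t) (at (\<phi> t) within \<gamma>)" .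
  show ?thesis
    unfolding has_field_derivative_iff
    by (rule Lim_transform_eventually[OF lim''], unfold eventually_at_filter)
      (intro always_eventually, auto simp: \<psi> elim!: trace_cases)
qed

text \<open>The choice in \<open>arc_deriv\<close> is harmless: any two candidates, multiplied by
  the nonzero \<open>\<phi>' t\<close>, are derivatives of the same function of the
  parameter.\<close>

lemma arc_deriv_eq:
  assumes z: "z \<in> \<gamma>" and D: "(G has_field_derivative D) (at z within \<gamma>)"
  shows "arc_deriv \<gamma> G z = D"
  unfolding arc_deriv_def
proof (rule some_equality)
  show "(G has_field_derivative D) (at z within \<gamma>)" by (rule D)
  fix D' assume D': "(G has_field_derivative D') (at z within \<gamma>)"
  obtain t where t: "t \<in> {0..1}" "z = \<phi> t" using z by (rule trace_cases)
  have "D' * \<phi>' t = D * \<phi>' t"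
    by (rule vector_derivative_unique_within_closed_interval[of 0 1 t "\<lambda>s. G (\<phi> s)"])
      (use has_vector_derivative_param[of t G D] has_vector_derivative_param[of t G D'] D D' t in auto)
  then show "D' = D" using nonzero[OF t(1)] by simp
qed

text \<open>A finite set is closed, so equality off \<open>S\<close> is equality near any point
  outside \<open>S\<close>. In the applications \<open>S\<close> consists of nodes, where
  \<open>divdiff\<close> takes default values from division by zero.\<close>

lemma arc_deriv_cong:
  assumes S: "finite S" and eq: "\<And>w. w \<in> \<gamma> - S \<Longrightarrow> G w = H w" and z: "z \<in> \<gamma> - S"
  shows "arc_deriv \<gamma> G z = arc_deriv \<gamma> H z"
proof -
  have "open (- S)" using S by (simp add: finite_imp_closed open_Compl)
  then have "\<forall>\<^sub>F w in at z within \<gamma>. w \<in> \<gamma> - S"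
    using z by (auto simp: eventually_at_topological)
  then have "\<forall>\<^sub>F w in at z within \<gamma>. G w = H w"
    by (rule eventually_mono) (rule eq)
  then show ?thesis
    unfolding arc_deriv_def using has_field_derivative_cong_eventually[of G H z \<gamma>] eq[OF z] by simp
qed

lemma arc_nderiv_eq:
  assumes S: "finite S" and g: "\<And>z. z \<in> \<gamma> - S \<Longrightarrow> g z = G 0 z"
    and G: "\<And>j z. j < r \<Longrightarrow> z \<in> \<gamma> - S \<Longrightarrow> (G j has_field_derivative G (Suc j) z) (at z within \<gamma>)"
    and m: "m \<le> r" and z: "z \<in> \<gamma> - S"
  shows "arc_nderiv \<gamma> m g z = G m z"
  using m z
proof (induction m arbitrary: z)
  case (Suc m)
  have "arc_deriv \<gamma> (arc_nderiv \<gamma> m g) z = arc_deriv \<gamma> (G m) z"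
    using Suc by (intro arc_deriv_cong[OF S]) auto
  also have "\<dots> = G (Suc m) z"
    using Suc.prems by (intro arc_deriv_eq G) auto
  finally show ?case by simp
qed (simp add: g)

end

section \<open>Derivatives of a difference quotient\<close>

text \<open>If \<open>G j\<close> is the \<open>j\<close>-th derivative of \<open>g\<close>, then \<open>dquot G a m\<close> is the \<open>m\<close>-th derivative of
  \<open>(g(z) - g(a)) / (z - a)\<close> away from \<open>a\<close>, and \<open>dquot_num G a m\<close> is that derivative multiplied by
  \<open>(z - a)^(m+1)\<close>, written so that it is smooth at \<open>a\<close> as well.\<close>

primrec dquot :: "(nat \<Rightarrow> complex \<Rightarrow> complex) \<Rightarrow> complex \<Rightarrow> nat \<Rightarrow> complex \<Rightarrow> complex" where
  "dquot G a 0 z = (G 0 z - G 0 a) / (z - a)"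
| "dquot G a (Suc m) z = (G (Suc m) z - of_nat (Suc m) * dquot G a m z) / (z - a)"

primrec dquot_num :: "(nat \<Rightarrow> complex \<Rightarrow> complex) \<Rightarrow> complex \<Rightarrow> nat \<Rightarrow> complex \<Rightarrow> complex" where
  "dquot_num G a 0 z = G 0 z - G 0 a"
| "dquot_num G a (Suc m) z = (z - a) ^ Suc m * G (Suc m) z - of_nat (Suc m) * dquot_num G a m z"

lemma dquot_num_base [simp]: "dquot_num G a m a = 0"
  by (induction m) auto

lemma dquot_eq:
  assumes "z \<noteq> a"
  shows "dquot G a m z = dquot_num G a m z / (z - a) ^ Suc m"
proof (induction m)
  case (Suc m)
  have "dquot G a (Suc m) z = (G (Suc m) z - of_nat (Suc m) * (dquot_num G a m z / (z - a) ^ Suc m)) / (z - a)"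
    by (simp only: dquot.simps Suc)
  also have "\<dots> = dquot_num G a (Suc m) z / (z - a) ^ Suc (Suc m)"
    using assms by (simp add: field_simps del: of_nat_Suc)
  finally show ?case .
qed simp

text \<open>The quotient rule, combined with \<open>(z - a) * dquot G a (Suc m) z = G (Suc m) z -
  of_nat (Suc m) * dquot G a m z\<close>, raises the coefficient of the last quotient by one and
  reproduces the recursion.\<close>

lemma has_field_derivative_dquot:
  assumes z: "z \<noteq> a"
    and G: "\<And>j. j \<le> m \<Longrightarrow> (G j has_field_derivative G (Suc j) z) (at z within X)"
  shows "(dquot G a m has_field_derivative dquot G a (Suc m) z) (at z within X)"
  using G
proof (induction m)
  case 0
  have "((\<lambda>z. (G 0 z - G 0 a) / (z - a)) has_field_derivative
      (G 1 z * (z - a) - (G 0 z - G 0 a)) / ((z - a) * (z - a))) (at z within X)"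
    using 0[of 0] z by (auto intro!: derivative_eq_intros)
  moreover have "(G 1 z * (z - a) - (G 0 z - G 0 a)) / ((z - a) * (z - a)) = dquot G a (Suc 0) z"
    using z by (simp add: field_simps)
  moreover have "dquot G a 0 = (\<lambda>z. (G 0 z - G 0 a) / (z - a))" by auto
  ultimately show ?case by simp
next
  case (Suc m)
  let ?c = "of_nat (Suc m) :: complex"
  have H: "(dquot G a m has_field_derivative dquot G a (Suc m) z) (at z within X)"
    using Suc by simp
  have "((\<lambda>z. (G (Suc m) z - ?c * dquot G a m z) / (z - a)) has_field_derivative
      ((G (Suc (Suc m)) z - ?c * dquot G a (Suc m) z) * (z - a) - (G (Suc m) z - ?c * dquot G a m z)) /
        ((z - a) * (z - a))) (at z within X)"
    using Suc.prems[of "Suc m"] H z by (auto intro!: derivative_eq_intros simp del: of_nat_Suc dquot.simps)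
  moreover have "((G (Suc (Suc m)) z - ?c * dquot G a (Suc m) z) * (z - a) - (G (Suc m) z - ?c * dquot G a m z)) /
        ((z - a) * (z - a)) = dquot G a (Suc (Suc m)) z"
  proof -
    have eq: "G (Suc m) z - ?c * dquot G a m z = (z - a) * dquot G a (Suc m) z"
      using z by simp
    have "((U - ?c * Y) * W - W * Y) / (W * W) = (U - (?c + 1) * Y) / W" if "W \<noteq> 0" for U Y W :: complex
      using that by (simp add: divide_simps) (simp add: algebra_simps)
    then have "((G (Suc (Suc m)) z - ?c * dquot G a (Suc m) z) * (z - a) - (z - a) * dquot G a (Suc m) z) /
        ((z - a) * (z - a)) = (G (Suc (Suc m)) z - (?c + 1) * dquot G a (Suc m) z) / (z - a)"
      using z by (metis right_minus_eq)
    also have "\<dots> = dquot G a (Suc (Suc m)) z"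
      by (simp only: dquot.simps(2)[of G a "Suc m"] of_nat_Suc[of "Suc m"] add.commute[of 1])
    finally show ?thesis unfolding eq .
  qed
  moreover have "dquot G a (Suc m) = (\<lambda>z. (G (Suc m) z - ?c * dquot G a m z) / (z - a))" by auto
  ultimately show ?case by simp
qed

text \<open>The product rule yields a term
  \<open>of_nat (Suc m) * (z - a) ^ m * G (Suc m) z\<close>, which cancels against the derivative of
  the preceding numerator. The last derivative is a free \<open>D\<close>, since at the top order it
  exists only almost everywhere.\<close>

lemma has_field_derivative_dquot_num:
  assumes G: "\<And>j. j < m \<Longrightarrow> (G j has_field_derivative G (Suc j) z) (at z within X)"
    and D: "(G m has_field_derivative D) (at z within X)"
  shows "(dquot_num G a m has_field_derivative (z - a) ^ m * D) (at z within X)"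
  using G D
proof (induction m arbitrary: D)
  case 0
  have "dquot_num G a 0 = (\<lambda>z. G 0 z - G 0 a)" by auto
  then show ?case using 0 by (auto intro!: derivative_eq_intros)
next
  case (Suc m)
  let ?c = "of_nat (Suc m) :: complex"
  have R: "(dquot_num G a m has_field_derivative (z - a) ^ m * G (Suc m) z) (at z within X)"
    using Suc by simp
  have "((\<lambda>z. (z - a) ^ Suc m * G (Suc m) z - ?c * dquot_num G a m z) has_field_derivative
      (?c * (z - a) ^ m * G (Suc m) z + (z - a) ^ Suc m * D) - ?c * ((z - a) ^ m * G (Suc m) z)) (at z within X)"
    using R Suc.prems(2)
    by (auto intro!: derivative_eq_intros simp del: of_nat_Suc power_Suc)
  moreover have "dquot_num G a (Suc m) = (\<lambda>z. (z - a) ^ Suc m * G (Suc m) z - ?c * dquot_num G a m z)"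
    by auto
  ultimately show ?case by (simp add: algebra_simps)
qed

section \<open>Chains of derivatives whose last member is Lipschitz\<close>

context regular_arc
begin

text \<open>The derivatives are carried as a family instead of by \<open>arc_nderiv\<close>, so that
  the members can be smooth continuations across nodes where the divided difference itself has a
  default value. Members beyond \<open>r\<close> are unconstrained.\<close>

definition lip_chain :: "nat \<Rightarrow> (nat \<Rightarrow> complex \<Rightarrow> complex) \<Rightarrow> bool" where
  "lip_chain r G \<longleftrightarrow>
    (\<forall>j<r. \<forall>z\<in>\<gamma>. (G j has_field_derivative G (Suc j) z) (at z within \<gamma>)) \<and>
    (\<exists>L. L-lipschitz_on {0..1} (\<lambda>t. G r (\<phi> t)))"

lemma lip_chain_deriv:
  "lip_chain r G \<Longrightarrow> j < r \<Longrightarrow> z \<in> \<gamma> \<Longrightarrow> (G j has_field_derivative G (Suc j) z) (at z within \<gamma>)"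
  by (simp add: lip_chain_def)

text \<open>Descending from \<open>r\<close>: a Lipschitz derivative is continuous, hence bounded on
  the compact interval, so the function below it is Lipschitz too.\<close>

lemma lip_chain_lipschitz:
  assumes G: "lip_chain r G" and m: "m \<le> r"
  shows "\<exists>L. L-lipschitz_on {0..1} (\<lambda>t. G m (\<phi> t))"
  using m
proof (induction rule: inc_induct)
  case base
  then show ?case using G by (simp add: lip_chain_def)
next
  case (step m)
  have "continuous_on {0..1} (\<lambda>t. G (Suc m) (\<phi> t) * \<phi>' t)"
    using step.IH by (auto intro!: continuous_intros C1 dest: lipschitz_on_continuous_on)
  then have "bounded ((\<lambda>t. G (Suc m) (\<phi> t) * \<phi>' t) ` {0..1})"
    by (intro compact_imp_bounded compact_continuous_image) auto
  then obtain B where B: "B > 0" "\<And>t. t \<in> {0..1} \<Longrightarrow> norm (G (Suc m) (\<phi> t) * \<phi>' t) \<le> B"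
    unfolding bounded_pos by auto
  have v: "((\<lambda>t. G m (\<phi> t)) has_vector_derivative G (Suc m) (\<phi> t) * \<phi>' t) (at t within {0..1})"
    if "t \<in> {0..1}" for t
    using lip_chain_deriv[OF G step.hyps(2), of "\<phi> t"] that by (intro has_vector_derivative_param) auto
  have "B-lipschitz_on {0..1} (\<lambda>t. G m (\<phi> t))"
  proof (rule lipschitz_on_finite_exceptional_derivative)
    show "finite ({}::real set)" by simp
    show "continuous_on {0..1} (\<lambda>t. G m (\<phi> t))"
      unfolding continuous_on_eq_continuous_within
      by (rule ballI, rule has_vector_derivative_continuous, rule v)
  qed (use v B in auto)
  then show ?case ..
qed

lemma lip_chain_ae_deriv:
  assumes G: "lip_chain r G" and m: "m \<le> r"
  shows "\<exists>N. negligible N \<and>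
    (\<forall>t \<in> {0..1} - N. (G m has_field_derivative arc_deriv \<gamma> (G m) (\<phi> t)) (at (\<phi> t) within \<gamma>))"
proof -
  obtain L where L: "L-lipschitz_on {0..1} (\<lambda>t. G m (\<phi> t))"
    using lip_chain_lipschitz[OF G m] by blast
  obtain g N where N: "negligible N"
    and g: "\<And>t. t \<in> {0..1} - N \<Longrightarrow> ((\<lambda>t. G m (\<phi> t)) has_vector_derivative g t) (at t within {0..1})"
    by (rule lipschitz_ae_vector_derivative[OF L]) (rule that; assumption)
  have "(G m has_field_derivative arc_deriv \<gamma> (G m) (\<phi> t)) (at (\<phi> t) within \<gamma>)" if t: "t \<in> {0..1} - N" for t
  proof -
    have D: "(G m has_field_derivative g t / \<phi>' t) (at (\<phi> t) within \<gamma>)"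
      using t by (intro has_field_derivative_from_param g) auto
    then show ?thesis using arc_deriv_eq[OF _ D] t by simp
  qed
  with N show ?thesis by blast
qed

lemma dquot_num_lipschitz:
  assumes G: "lip_chain r G" and m: "m \<le> r"
  shows "\<exists>L. L-lipschitz_on {0..1} (\<lambda>t. dquot_num G a m (\<phi> t))"
  using m
proof (induction m)
  case 0
  obtain L where "L-lipschitz_on {0..1} (\<lambda>t. G 0 (\<phi> t))"
    using lip_chain_lipschitz[OF G] by blast
  then have "(L + 0)-lipschitz_on {0..1} (\<lambda>t. G 0 (\<phi> t) - G 0 a)"
    by (intro lipschitz_on_diff lipschitz_on_constant)
  then show ?case by auto
next
  case (Suc m)
  obtain K where "K-lipschitz_on {0..1} \<phi>" using lipschitz_param by blast
  then have 1: "(K + 0)-lipschitz_on {0..1} (\<lambda>t. \<phi> t - a)"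
    by (intro lipschitz_on_diff lipschitz_on_constant)
  have "\<exists>L. L-lipschitz_on {0..1} (\<lambda>t. (\<phi> t - a) ^ j)" for j
  proof (induction j)
    case (Suc j)
    then show ?case using lipschitz_on_mult_compact[OF _ 1] by (auto simp del: add_0_right)
  qed (use lipschitz_on_constant in force)
  then obtain A where A: "A-lipschitz_on {0..1} (\<lambda>t. (\<phi> t - a) ^ Suc m)" by blast
  obtain L where L: "L-lipschitz_on {0..1} (\<lambda>t. G (Suc m) (\<phi> t))"
    using lip_chain_lipschitz[OF G] Suc by blast
  obtain P where P: "P-lipschitz_on {0..1} (\<lambda>t. (\<phi> t - a) ^ Suc m * G (Suc m) (\<phi> t))"
    using lipschitz_on_mult_compact[OF _ A L] by auto
  obtain R where "R-lipschitz_on {0..1} (\<lambda>t. dquot_num G a m (\<phi> t))" using Suc by auto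
  then obtain Q where Q: "Q-lipschitz_on {0..1} (\<lambda>t. of_nat (Suc m) * dquot_num G a m (\<phi> t))"
    using lipschitz_on_mult_compact[OF _ lipschitz_on_constant] by (metis compact_Icc)
  show ?case using lipschitz_on_diff[OF P Q] unfolding dquot_num.simps by blast
qed

text \<open>The numerator is Lipschitz in the parameter, so an almost everywhere derivative
  integrates back to it. \<open>D\<close> is arbitrary off \<open>N\<close>, which later admits an
  iterated derivative of \<open>divdiff\<close> that is controlled only off the nodes.\<close>

lemma has_integral_dquot_num:
  assumes G: "lip_chain r G" and m: "m \<le> r" and N: "negligible N"
    and D: "\<And>t. t \<in> {0..1} - N \<Longrightarrow> (G m has_field_derivative D (\<phi> t)) (at (\<phi> t) within \<gamma>)"
    and st: "0 \<le> s" "s \<le> t" "t \<le> 1"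
  shows "((\<lambda>u. (\<phi> u - a) ^ m * D (\<phi> u) * \<phi>' u) has_integral
    dquot_num G a m (\<phi> t) - dquot_num G a m (\<phi> s)) {s..t}"
proof -
  obtain L where L: "L-lipschitz_on {0..1} (\<lambda>t. dquot_num G a m (\<phi> t))"
    using dquot_num_lipschitz[OF G m] by blast
  show ?thesis
  proof (rule has_integral_lipschitz_derivative[OF L N _ st])
    fix u assume u: "u \<in> {0..1} - N"
    show "((\<lambda>t. dquot_num G a m (\<phi> t)) has_vector_derivative (\<phi> u - a) ^ m * D (\<phi> u) * \<phi>' u) (at u within {0..1})"
      using u m by (intro has_vector_derivative_param has_field_derivative_dquot_num D lip_chain_deriv[OF G]) auto
  qed
qed

text \<open>Only one endpoint contributes, because \<open>dquot_num\<close> vanishes at the base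
  point; for \<open>t\<close> before \<alpha> the sign in \<open>arc_integral\<close> restores the
  orientation.\<close>

lemma arc_integral_dquot_num:
  assumes G: "lip_chain r G" and m: "m \<le> r" and N: "negligible N"
    and D: "\<And>t. t \<in> {0..1} - N \<Longrightarrow> (G m has_field_derivative D (\<phi> t)) (at (\<phi> t) within \<gamma>)"
    and st: "\<alpha> \<in> {0..1}" "t \<in> {0..1}"
  shows "arc_integral \<phi> \<phi>' (\<lambda>z. (z - \<phi> \<alpha>) ^ m * D z) \<alpha> t = dquot_num G (\<phi> \<alpha>) m (\<phi> t)"
proof -
  note * = has_integral_dquot_num[OF G m N D, THEN integral_unique]
  show ?thesis
    unfolding arc_integral_def using *[of \<alpha> t "\<phi> \<alpha>"] *[of t \<alpha> "\<phi> \<alpha>"] st by auto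
qed

text \<open>The numerator is an integral from \<alpha> whose integrand is at most
  \<open>(K * \<bar>t - \<alpha>\<bar>) ^ m * L\<close>, so it is of order \<open>Suc m\<close> in
  \<open>t - \<alpha>\<close>. By the chord-arc inequality the denominator is at least of the same
  order. The case \<open>m = r\<close> is included and yields the bound at the top order.\<close>

lemma dquot_bounded:
  assumes G: "lip_chain r G" and m: "m \<le> r" and \<alpha>: "\<alpha> \<in> {0..1}"
  obtains B where "B > 0" "\<And>z. z \<in> \<gamma> - {\<phi> \<alpha>} \<Longrightarrow> norm (dquot G (\<phi> \<alpha>) m z) \<le> B"
proof -
  obtain L where L: "L-lipschitz_on {0..1} (\<lambda>t. G m (\<phi> t))"
    using lip_chain_lipschitz[OF G m] by blast
  have L0: "L \<ge> 0" using L by (rule lipschitz_on_nonneg)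
  obtain K where K: "K-lipschitz_on {0..1} \<phi>" using lipschitz_param by blast
  have K0: "K \<ge> 0" using K by (rule lipschitz_on_nonneg)
  obtain c where c: "c > 0" "\<And>t. t \<in> {0..1} \<Longrightarrow> c * \<bar>t - \<alpha>\<bar> \<le> norm (\<phi> t - \<phi> \<alpha>)"
    using chord_arc[OF \<alpha>] by blast
  obtain N where N: "negligible N"
    and D: "\<And>t. t \<in> {0..1} - N \<Longrightarrow> (G m has_field_derivative arc_deriv \<gamma> (G m) (\<phi> t)) (at (\<phi> t) within \<gamma>)"
    using lip_chain_ae_deriv[OF G m] by blast
  \<comment> \<open>Setting the integrand to zero on \<open>N\<close> makes its bound hold
    everywhere without changing the integral.\<close>
  define w where "w = (\<lambda>u. if u \<in> N then 0 else (\<phi> u - \<phi> \<alpha>) ^ m * arc_deriv \<gamma> (G m) (\<phi> u) * \<phi>' u)"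
  have int: "(w has_integral dquot_num G (\<phi> \<alpha>) m (\<phi> t) - dquot_num G (\<phi> \<alpha>) m (\<phi> s)) {s..t}"
    if "0 \<le> s" "s \<le> t" "t \<le> 1" for s t
    by (rule has_integral_spike[OF N _ has_integral_dquot_num[OF G m N D that]]) (auto simp: w_def)
  have wb: "norm (w u) \<le> (K * d) ^ m * L" if u: "u \<in> {0..1}" "\<bar>u - \<alpha>\<bar> \<le> d" for u d
  proof (cases "u \<in> N")
    case True
    then show ?thesis using L0 K0 u by (simp add: w_def)
  next
    case False
    have 1: "norm (arc_deriv \<gamma> (G m) (\<phi> u) * \<phi>' u) \<le> L"
      by (rule lipschitz_on_vector_derivative_bound[OF L _ u(1) has_vector_derivative_param[OF u(1) D]])
        (use u False in auto)
    have "norm (\<phi> u - \<phi> \<alpha>) \<le> K * \<bar>u - \<alpha>\<bar>"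
      using lipschitz_onD[OF K u(1) \<alpha>] by (simp add: dist_norm)
    also have "\<dots> \<le> K * d" using u K0 by (intro mult_left_mono) auto
    finally have 2: "norm ((\<phi> u - \<phi> \<alpha>) ^ m) \<le> (K * d) ^ m"
      by (simp add: norm_power power_mono)
    have "norm ((\<phi> u - \<phi> \<alpha>) ^ m * (arc_deriv \<gamma> (G m) (\<phi> u) * \<phi>' u)) \<le> (K * d) ^ m * L"
      unfolding norm_mult[of "(\<phi> u - \<phi> \<alpha>) ^ m"] using u K0
      by (intro mult_mono 1 2) auto
    then show ?thesis using False by (simp add: w_def mult.assoc)
  qed
  have num: "norm (dquot_num G (\<phi> \<alpha>) m (\<phi> t)) \<le> (K * \<bar>t - \<alpha>\<bar>) ^ m * L * \<bar>t - \<alpha>\<bar>"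
    if t: "t \<in> {0..1}" for t
  proof (cases "\<alpha> \<le> t")
    case True
    have "norm (dquot_num G (\<phi> \<alpha>) m (\<phi> t) - dquot_num G (\<phi> \<alpha>) m (\<phi> \<alpha>)) \<le>
        (K * \<bar>t - \<alpha>\<bar>) ^ m * L * measure lborel {\<alpha>..t}"
      using t \<alpha> True L0 K0
      by (intro has_integral_bound_real[OF _ _ int, where S = "{}"] wb) auto
    then show ?thesis using True by simp
  next
    case False
    have "norm (dquot_num G (\<phi> \<alpha>) m (\<phi> \<alpha>) - dquot_num G (\<phi> \<alpha>) m (\<phi> t)) \<le>
        (K * \<bar>t - \<alpha>\<bar>) ^ m * L * measure lborel {t..\<alpha>}"
      using t \<alpha> False L0 K0
      by (intro has_integral_bound_real[OF _ _ int, where S = "{}"] wb) auto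
    then show ?thesis using False by simp
  qed
  show ?thesis
  proof
    \<comment> \<open>The summand \<open>1\<close> only makes the bound strictly positive.\<close>
    show "K ^ m * L / c ^ Suc m + 1 > 0" using L0 K0 c by (auto intro!: add_nonneg_pos)
    fix z assume "z \<in> \<gamma> - {\<phi> \<alpha>}"
    moreover from this obtain t where "t \<in> {0..1}" "z = \<phi> t" using trace_cases by blast
    ultimately have t: "t \<in> {0..1}" "z = \<phi> t" "t \<noteq> \<alpha>" by auto
    let ?d = "\<bar>t - \<alpha>\<bar>"
    have d: "?d > 0" using t by simp
    have "norm (dquot G (\<phi> \<alpha>) m z) = norm (dquot_num G (\<phi> \<alpha>) m (\<phi> t)) / norm (\<phi> t - \<phi> \<alpha>) ^ Suc m"
      using t \<alpha> by (simp only: dquot_eq param_eq_iff norm_divide norm_power simp_thms)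
    also have "\<dots> \<le> ((K * ?d) ^ m * L * ?d) / (c * ?d) ^ Suc m"
      using num[OF t(1)] c d L0 K0 t(1) by (intro frac_le power_mono) auto
    also have "\<dots> = K ^ m * L / c ^ Suc m"
      using d c by (simp add: power_mult_distrib field_simps)
    finally show "norm (dquot G (\<phi> \<alpha>) m z) \<le> K ^ m * L / c ^ Suc m + 1" by simp
  qed
qed

section \<open>Continuation of the difference quotient across its base point\<close>

text \<open>The value at \<open>a\<close> is what the identity \<open>(z - a) * dquot G a (Suc m) z
  + of_nat (Suc m) * dquot G a m z = G (Suc m) z\<close> forces in the limit when
  \<open>dquot G a (Suc m)\<close> stays bounded.\<close>

definition dquot_ext :: "(nat \<Rightarrow> complex \<Rightarrow> complex) \<Rightarrow> complex \<Rightarrow> nat \<Rightarrow> complex \<Rightarrow> complex" where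
  "dquot_ext G a m z = (if z = a then G (Suc m) a / of_nat (Suc m) else dquot G a m z)"

lemma dquot_ext_diff:
  assumes "z \<noteq> a"
  shows "dquot_ext G a m z - dquot_ext G a m a =
    (G (Suc m) z - G (Suc m) a - (z - a) * dquot G a (Suc m) z) / of_nat (Suc m)"
proof -
  have "(z - a) * dquot G a (Suc m) z = G (Suc m) z - of_nat (Suc m) * dquot G a m z"
    using assms by simp
  then show ?thesis
    using assms by (simp only:) (simp add: dquot_ext_def field_simps del: of_nat_Suc)
qed

text \<open>By \<open>dquot_ext_diff\<close> the increment is governed by that of the continuous
  \<open>G (Suc m)\<close> and by \<open>z - a\<close> times \<open>dquot G a (Suc m)\<close>, which
  is bounded since \<open>Suc m \<le> r\<close>.\<close>

lemma tendsto_dquot_ext: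
  assumes G: "lip_chain r G" and m: "m < r" and \<alpha>: "\<alpha> \<in> {0..1}"
  shows "(dquot_ext G (\<phi> \<alpha>) m \<longlongrightarrow> dquot_ext G (\<phi> \<alpha>) m (\<phi> \<alpha>)) (at (\<phi> \<alpha>) within \<gamma>)"
proof -
  let ?a = "\<phi> \<alpha>"
  obtain B where B: "B > 0" "\<And>z. z \<in> \<gamma> - {?a} \<Longrightarrow> norm (dquot G ?a (Suc m) z) \<le> B"
    using dquot_bounded[OF G _ \<alpha>, of "Suc m"] m by auto
  have "continuous_on \<gamma> (G (Suc m))"
    using lip_chain_lipschitz[OF G, of "Suc m"] m
    by (intro continuous_on_trace) (auto dest: lipschitz_on_continuous_on)
  then have 1: "((\<lambda>z. G (Suc m) z - G (Suc m) ?a) \<longlongrightarrow> G (Suc m) ?a - G (Suc m) ?a) (at ?a within \<gamma>)"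
    using \<alpha> by (intro tendsto_diff tendsto_const) (simp add: continuous_on_def)
  have "((\<lambda>z. (z - ?a) * dquot G ?a (Suc m) z) \<longlongrightarrow> 0) (at ?a within \<gamma>)"
  proof (rule Lim_null_comparison)
    show "\<forall>\<^sub>F z in at ?a within \<gamma>. norm ((z - ?a) * dquot G ?a (Suc m) z) \<le> norm (z - ?a) * B"
      unfolding eventually_at_filter
      by (intro always_eventually allI impI) (auto simp: norm_mult intro!: mult_left_mono B simp del: dquot.simps)
    have "((\<lambda>z. norm (z - ?a) * B) \<longlongrightarrow> norm (?a - ?a) * B) (at ?a within \<gamma>)"
      by (intro tendsto_intros)
    then show "((\<lambda>z. norm (z - ?a) * B) \<longlongrightarrow> 0) (at ?a within \<gamma>)" by simp
  qed
  from tendsto_diff[OF 1 this]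
  have "((\<lambda>z. (G (Suc m) z - G (Suc m) ?a - (z - ?a) * dquot G ?a (Suc m) z) / of_nat (Suc m)) \<longlongrightarrow> 0 / of_nat (Suc m))
    (at ?a within \<gamma>)" by (intro tendsto_divide) (auto simp del: of_nat_Suc dquot.simps)
  then have "((\<lambda>z. dquot_ext G ?a m z - dquot_ext G ?a m ?a) \<longlongrightarrow> 0 / of_nat (Suc m)) (at ?a within \<gamma>)"
    by (rule Lim_transform_eventually)
      (auto simp: eventually_at_filter dquot_ext_diff simp del: dquot.simps of_nat_Suc)
  then have "((\<lambda>z. dquot_ext G ?a m z - dquot_ext G ?a m ?a) \<longlongrightarrow> 0) (at ?a within \<gamma>)" by simp
  then show ?thesis by (rule LIM_zero_cancel)
qed

text \<open>Away from the base point this is the derivative of \<open>dquot\<close>. At the base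
  point the quotient tends to \<open>(X - X / (m + 2)) / (m + 1) = X / (m + 2)\<close>, where
  \<open>X\<close> is the value of \<open>G (Suc (Suc m))\<close> there, and this is exactly the
  prescribed value of the next member.\<close>

lemma has_field_derivative_dquot_ext:
  assumes G: "lip_chain r G" and m: "Suc m < r" and \<alpha>: "\<alpha> \<in> {0..1}" and z: "z \<in> \<gamma>"
  shows "(dquot_ext G (\<phi> \<alpha>) m has_field_derivative dquot_ext G (\<phi> \<alpha>) (Suc m) z) (at z within \<gamma>)"
proof (cases "z = \<phi> \<alpha>")
  case False
  have "(dquot G (\<phi> \<alpha>) m has_field_derivative dquot G (\<phi> \<alpha>) (Suc m) z) (at z within \<gamma>)"
    using m z by (intro has_field_derivative_dquot False lip_chain_deriv[OF G]) auto
  moreover have "\<forall>\<^sub>F w in at z within \<gamma>. dquot G (\<phi> \<alpha>) m w = dquot_ext G (\<phi> \<alpha>) m w"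
    using eventually_neq_at_within[of "\<phi> \<alpha>" z \<gamma>] by eventually_elim (simp add: dquot_ext_def)
  ultimately show ?thesis
    using False has_field_derivative_cong_eventually[of "dquot G (\<phi> \<alpha>) m" "dquot_ext G (\<phi> \<alpha>) m" z \<gamma>]
    by (simp add: dquot_ext_def del: dquot.simps)
next
  case True
  let ?a = "\<phi> \<alpha>" and ?c = "of_nat (Suc m) :: complex" and ?X = "G (Suc (Suc m)) (\<phi> \<alpha>)"
  have c: "?c \<noteq> 0" "?c + 1 \<noteq> 0" 
    by (rule of_nat_neq_0) (metis of_nat_neq_0 of_nat_Suc add.commute)
  have "((\<lambda>w. (G (Suc m) w - G (Suc m) ?a) / (w - ?a)) \<longlongrightarrow> ?X) (at ?a within \<gamma>)"
    using lip_chain_deriv[OF G m, of ?a] \<alpha> by (simp add: has_field_derivative_iff)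
  then have lim: "((\<lambda>w. ((G (Suc m) w - G (Suc m) ?a) / (w - ?a) - dquot_ext G ?a (Suc m) w) / ?c)
      \<longlongrightarrow> (?X - dquot_ext G ?a (Suc m) ?a) / ?c) (at ?a within \<gamma>)"
    by (intro tendsto_divide tendsto_diff tendsto_const tendsto_dquot_ext[OF G m \<alpha>] c)
  have "((G (Suc m) w - G (Suc m) ?a) / (w - ?a) - dquot_ext G ?a (Suc m) w) / ?c =
      (dquot_ext G ?a m w - dquot_ext G ?a m ?a) / (w - ?a)" if w: "w \<noteq> ?a" for w
  proof -
    have "(X / W - Y) / C = ((X - W * Y) / C) / W" if "W \<noteq> 0" for X Y W C :: complex
      using that by (simp add: divide_simps)
    from this[of "w - ?a"] w show ?thesis
      by (simp add: dquot_ext_diff[OF w] del: dquot.simps of_nat_Suc) (simp add: dquot_ext_def del: dquot.simps of_nat_Suc)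
  qed
  then have "((\<lambda>w. (dquot_ext G ?a m w - dquot_ext G ?a m ?a) / (w - ?a))
      \<longlongrightarrow> (?X - dquot_ext G ?a (Suc m) ?a) / ?c) (at ?a within \<gamma>)"
    by (intro Lim_transform_eventually[OF lim]) (auto simp: eventually_at_filter)
  moreover have "(?X - dquot_ext G ?a (Suc m) ?a) / ?c = dquot_ext G ?a (Suc m) ?a"
  proof -
    have "(?X - ?X / (?c + 1)) / ?c = ?X / (?c + 1)"
      using c by (simp add: divide_simps del: of_nat_Suc) (simp add: algebra_simps)
    then show ?thesis
      by (simp only: dquot_ext_def if_True simp_thms of_nat_Suc[of "Suc m"] add.commute[of 1])
  qed
  ultimately show ?thesis by (simp add: True has_field_derivative_iff)
qed

text \<open>One order is lost: the last member is only continuous at the base point, but elsewhere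
  its derivative is the bounded \<open>dquot G (\<phi> \<alpha>) (Suc r)\<close>, which makes it
  Lipschitz.\<close>

lemma lip_chain_dquot_ext:
  assumes G: "lip_chain (Suc r) G" and \<alpha>: "\<alpha> \<in> {0..1}"
  shows "lip_chain r (dquot_ext G (\<phi> \<alpha>))"
  unfolding lip_chain_def
proof (intro conjI allI impI ballI)
  fix j z assume "j < r" "z \<in> \<gamma>"
  then show "(dquot_ext G (\<phi> \<alpha>) j has_field_derivative dquot_ext G (\<phi> \<alpha>) (Suc j) z) (at z within \<gamma>)"
    by (intro has_field_derivative_dquot_ext[OF G _ \<alpha>]) auto
next
  let ?a = "\<phi> \<alpha>"
  obtain B where B: "B > 0" "\<And>z. z \<in> \<gamma> - {?a} \<Longrightarrow> norm (dquot G ?a (Suc r) z) \<le> B"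
    using dquot_bounded[OF G _ \<alpha>, of "Suc r"] by auto
  have "bounded (\<phi>' ` {0..1})"
    by (intro compact_imp_bounded compact_continuous_image C1) simp
  then obtain A where A: "A > 0" "\<And>t. t \<in> {0..1} \<Longrightarrow> norm (\<phi>' t) \<le> A"
    unfolding bounded_pos by auto
  have D: "(dquot_ext G ?a r has_field_derivative dquot G ?a (Suc r) z) (at z within \<gamma>)"
    if z: "z \<in> \<gamma>" "z \<noteq> ?a" for z
  proof -
    have "(dquot G ?a r has_field_derivative dquot G ?a (Suc r) z) (at z within \<gamma>)"
      using z by (intro has_field_derivative_dquot lip_chain_deriv[OF G]) auto
    moreover have "\<forall>\<^sub>F w in at z within \<gamma>. dquot G ?a r w = dquot_ext G ?a r w"
      using eventually_neq_at_within[of ?a z \<gamma>] by eventually_elim (simp add: dquot_ext_def)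
    ultimately show ?thesis
      using z has_field_derivative_cong_eventually[of "dquot G ?a r" "dquot_ext G ?a r" z \<gamma>]
      by (simp add: dquot_ext_def del: dquot.simps)
  qed
  have "continuous (at z within \<gamma>) (dquot_ext G ?a r)" if z: "z \<in> \<gamma>" for z
  proof (cases "z = ?a")
    case True
    then show ?thesis using tendsto_dquot_ext[OF G _ \<alpha>, of r] by (simp add: continuous_within)
  next
    case False
    then show ?thesis using D[OF z] DERIV_continuous by blast
  qed
  then have "continuous_on \<gamma> (dquot_ext G ?a r)"
    by (simp add: continuous_on_eq_continuous_within)
  then have cont: "continuous_on {0..1} (\<lambda>t. dquot_ext G ?a r (\<phi> t))"
    by (rule continuous_on_compose2[OF _ continuous_param]) (auto simp: trace_def)
  have "(B * A)-lipschitz_on {0..1} (\<lambda>t. dquot_ext G ?a r (\<phi> t))"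
  proof (rule lipschitz_on_finite_exceptional_derivative[OF _ cont])
    fix t assume t: "t \<in> {0..1} - {\<alpha>}"
    then have t': "\<phi> t \<noteq> ?a" using \<alpha> by (simp add: param_eq_iff)
    show "((\<lambda>t. dquot_ext G ?a r (\<phi> t)) has_vector_derivative dquot G ?a (Suc r) (\<phi> t) * \<phi>' t) (at t within {0..1})"
      using t t' by (intro has_vector_derivative_param D) auto
    show "norm (dquot G ?a (Suc r) (\<phi> t) * \<phi>' t) \<le> B * A"
      unfolding norm_mult using t t' A B by (intro mult_mono) auto
  qed (use A B in auto)
  then show "\<exists>L. L-lipschitz_on {0..1} (\<lambda>t. dquot_ext G ?a r (\<phi> t))" ..
qed

section \<open>Divided differences with distinct nodes on the arc\<close>

text \<open>Each recursion step of \<open>divdiff\<close> is a difference quotient of the preceding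
  order in its first argument, with the new node as base point, and costs one order of the chain.
  Agreement is claimed only off the nodes, where no division by zero occurs.\<close>

lemma divdiff_lip_chain:
  assumes f: "lip_chain r (\<lambda>j. arc_nderiv \<gamma> j f)" and k: "k \<le> r"
    and s: "\<And>i. i \<in> {1..k} \<Longrightarrow> s i \<in> {0..1}" and inj_s: "inj_on s {1..k}"
  shows "\<exists>G. lip_chain (r - k) G \<and>
    (\<forall>z \<in> \<gamma> - \<phi> ` s ` {1..k}. divdiff f k ((\<lambda>j. \<phi> (s j))(0 := z)) = G 0 z)"
  using k s inj_s
proof (induction k)
  case 0
  then show ?case using f by (intro exI[of _ "\<lambda>j. arc_nderiv \<gamma> j f"]) simp
next
  case (Suc k)
  have sub: "{1..k} \<subseteq> {1..Suc k}" by auto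
  have "\<exists>G. lip_chain (r - k) G \<and>
    (\<forall>z \<in> \<gamma> - \<phi> ` s ` {1..k}. divdiff f k ((\<lambda>j. \<phi> (s j))(0 := z)) = G 0 z)"
    using Suc.prems sub by (intro Suc.IH) (auto intro: inj_on_subset)
  then obtain G where G: "lip_chain (r - k) G"
    and eq: "\<And>z. z \<in> \<gamma> - \<phi> ` s ` {1..k} \<Longrightarrow> divdiff f k ((\<lambda>j. \<phi> (s j))(0 := z)) = G 0 z"
    by blast
  define \<alpha> where "\<alpha> = s (Suc k)"
  have \<alpha>: "\<alpha> \<in> {0..1}" using Suc.prems(2) by (simp add: \<alpha>_def)
  have "\<phi> \<alpha> \<notin> \<phi> ` s ` {1..k}"
  proof
    assume "\<phi> \<alpha> \<in> \<phi> ` s ` {1..k}"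
    then obtain i where i: "i \<in> {1..k}" "\<phi> (s (Suc k)) = \<phi> (s i)" by (auto simp: \<alpha>_def)
    then have "s (Suc k) = s i"
      using param_eq_iff[of "s (Suc k)" "s i"] Suc.prems(2)[of "Suc k"] Suc.prems(2)[of i] by simp
    then show False using inj_onD[OF Suc.prems(3), of "Suc k" i] i by simp
  qed
  \<comment> \<open>The new node differs from the earlier ones, so the second term of the recursion
    is the value of \<open>G 0\<close> there and not a default value.\<close>
  then have a: "\<phi> \<alpha> \<in> \<gamma> - \<phi> ` s ` {1..k}" using \<alpha> by simp
  have "lip_chain (r - Suc k) (dquot_ext G (\<phi> \<alpha>))"
    using lip_chain_dquot_ext[OF _ \<alpha>, of "r - Suc k" G] G Suc.prems(1) by (simp add: Suc_diff_Suc)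
  moreover have "divdiff f (Suc k) ((\<lambda>j. \<phi> (s j))(0 := z)) = dquot_ext G (\<phi> \<alpha>) 0 z"
    if z: "z \<in> \<gamma> - \<phi> ` s ` {1..Suc k}" for z
  proof -
    have "z \<in> \<gamma> - \<phi> ` s ` {1..k}" "z \<noteq> \<phi> \<alpha>"
      using z by (auto simp: \<alpha>_def atLeastAtMostSuc_conv)
    then show ?thesis using eq[of z] eq[OF a] by (simp add: dquot_ext_def \<alpha>_def)
  qed
  ultimately show ?case by blast
qed

text \<open>A chain \<open>G\<close> of length \<open>r - k\<close> for the difference of order
  \<open>k\<close> yields all three claims for order \<open>Suc k\<close>:
  \<open>dquot_bounded\<close> gives the bound at the top order, \<open>dquot_ext\<close> the
  absolutely continuous extensions below it, and \<open>dquot_num\<close> the integral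
  formula.\<close>

lemma divdiff_arc:
  assumes f: "lip_chain r (\<lambda>j. arc_nderiv \<gamma> j f)" and k: "k \<le> r"
    and s: "\<And>i. i \<in> {1..Suc k} \<Longrightarrow> s i \<in> {0..1}" and inj_s: "inj_on s {1..Suc k}"
  defines "D \<equiv> \<lambda>m. arc_nderiv \<gamma> m (\<lambda>\<zeta>. divdiff f (Suc k) ((\<lambda>j. \<phi> (s j))(0 := \<zeta>)))"
    and "E \<equiv> \<lambda>m. arc_nderiv \<gamma> m (\<lambda>\<zeta>. divdiff f k ((\<lambda>j. \<phi> (s j))(0 := \<zeta>)))"
  shows "\<exists>B. AE t in lborel. t \<in> {0..1} \<longrightarrow> norm (D (r - k) (\<phi> t)) \<le> B"
    and "\<And>m. m < r - k \<Longrightarrow> \<exists>h. absolutely_continuous_on 0 1 h \<and>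
      (\<forall>t\<in>{0..1}. t \<notin> s ` {1..Suc k} \<longrightarrow> h t = D m (\<phi> t))"
    and "\<And>m t. m \<le> r - k \<Longrightarrow> t \<in> {0..1} \<Longrightarrow> t \<notin> s ` {1..Suc k} \<Longrightarrow>
      D m (\<phi> t) = arc_integral \<phi> \<phi>' (\<lambda>z. (z - \<phi> (s (Suc k))) ^ m * E (m + 1) z) (s (Suc k)) t
        / (\<phi> t - \<phi> (s (Suc k))) ^ (m + 1)"
proof -
  define S where "S = \<phi> ` s ` {1..k}"
  define \<alpha> where "\<alpha> = s (Suc k)"
  have finS: "finite S" by (simp add: S_def)
  have nodes: "\<phi> ` s ` {1..Suc k} = insert (\<phi> \<alpha>) S"
    by (auto simp: S_def \<alpha>_def atLeastAtMostSuc_conv)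
  have sub: "{1..k} \<subseteq> {1..Suc k}" by auto
  have \<alpha>: "\<alpha> \<in> {0..1}" using s[of "Suc k"] by (simp add: \<alpha>_def)
  have off: "\<phi> t \<in> \<gamma> - \<phi> ` s ` A" if t: "t \<in> {0..1}" "t \<notin> s ` A" "A \<subseteq> {1..Suc k}" for t A
  proof -
    have "\<phi> t \<noteq> \<phi> (s i)" if "i \<in> A" for i
      using t that s[of i] by (subst param_eq_iff) auto
    then show ?thesis using t(1) by auto
  qed
  have "\<alpha> \<notin> s ` {1..k}"
  proof
    assume "\<alpha> \<in> s ` {1..k}"
    then obtain i where i: "i \<in> {1..k}" "s (Suc k) = s i" by (auto simp: \<alpha>_def)
    then show False using inj_onD[OF inj_s, of "Suc k" i] by simp
  qed
  then have a: "\<phi> \<alpha> \<in> \<gamma> - S"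
    unfolding S_def by (intro off[OF \<alpha> _ sub])
  obtain G where G: "lip_chain (r - k) G"
    and eq: "\<And>z. z \<in> \<gamma> - S \<Longrightarrow> divdiff f k ((\<lambda>j. \<phi> (s j))(0 := z)) = G 0 z"
  proof -
    have "\<exists>G. lip_chain (r - k) G \<and>
        (\<forall>z \<in> \<gamma> - \<phi> ` s ` {1..k}. divdiff f k ((\<lambda>j. \<phi> (s j))(0 := z)) = G 0 z)"
      using k sub by (intro divdiff_lip_chain[OF f] s inj_on_subset[OF inj_s]) auto
    then show ?thesis using that unfolding S_def by blast
  qed
  have D: "D m z = dquot G (\<phi> \<alpha>) m z" if m: "m \<le> r - k" and z: "z \<in> \<gamma> - insert (\<phi> \<alpha>) S" for m z
    unfolding D_def
  proof (rule arc_nderiv_eq[OF _ _ _ m z])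
    show "finite (insert (\<phi> \<alpha>) S)" using finS by simp
    show "divdiff f (Suc k) ((\<lambda>j. \<phi> (s j))(0 := w)) = dquot G (\<phi> \<alpha>) 0 w"
      if "w \<in> \<gamma> - insert (\<phi> \<alpha>) S" for w
      using eq[of w] eq[OF a] that by (simp add: \<alpha>_def)
    show "(dquot G (\<phi> \<alpha>) j has_field_derivative dquot G (\<phi> \<alpha>) (Suc j) w) (at w within \<gamma>)"
      if "j < r - k" "w \<in> \<gamma> - insert (\<phi> \<alpha>) S" for j w
      using that by (intro has_field_derivative_dquot lip_chain_deriv[OF G]) auto
  qed
  \<comment> \<open>For \<open>m = r - k\<close> this order lies beyond the chain, so the result is
    left as an \<open>arc_deriv\<close>, which is a genuine derivative only almost
    everywhere.\<close>
  have E: "E (Suc m) z = arc_deriv \<gamma> (G m) z" if m: "m \<le> r - k" and z: "z \<in> \<gamma> - S" for m z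
    unfolding E_def arc_nderiv.simps
  proof (rule arc_deriv_cong[OF finS _ z])
    show "arc_nderiv \<gamma> m (\<lambda>\<zeta>. divdiff f k ((\<lambda>j. \<phi> (s j))(0 := \<zeta>))) w = G m w" if w: "w \<in> \<gamma> - S" for w
      by (rule arc_nderiv_eq[where G = G, OF finS _ _ m w]) (auto intro: lip_chain_deriv[OF G] eq)
  qed
  show "\<exists>B. AE t in lborel. t \<in> {0..1} \<longrightarrow> norm (D (r - k) (\<phi> t)) \<le> B"
  proof -
    obtain B where B: "B > 0" "\<And>z. z \<in> \<gamma> - {\<phi> \<alpha>} \<Longrightarrow> norm (dquot G (\<phi> \<alpha>) (r - k) z) \<le> B"
      using dquot_bounded[OF G order_refl \<alpha>] by blast
    have "AE t in lborel. t \<notin> s ` {1..Suc k}"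
      by (rule AE_not_in) (simp add: finite_imp_null_set_lborel)
    then have "AE t in lborel. t \<in> {0..1} \<longrightarrow> norm (D (r - k) (\<phi> t)) \<le> B"
    proof eventually_elim
      case (elim t)
      show ?case
      proof
        assume "t \<in> {0..1}"
        then have z: "\<phi> t \<in> \<gamma> - insert (\<phi> \<alpha>) S"
          using off[of t "{1..Suc k}"] elim by (simp only: nodes subset_refl simp_thms)
        then show "norm (D (r - k) (\<phi> t)) \<le> B" using B(2)[of "\<phi> t"] D[OF order_refl z] by simp
      qed
    qed
    then show ?thesis ..
  qed
  show "\<exists>h. absolutely_continuous_on 0 1 h \<and>
      (\<forall>t\<in>{0..1}. t \<notin> s ` {1..Suc k} \<longrightarrow> h t = D m (\<phi> t))" if m: "m < r - k" for m
  proof -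
    \<comment> \<open>The extended chain is one shorter, and its length covers exactly the orders
      \<open>m < r - k\<close>.\<close>
    have "lip_chain (r - Suc k) (dquot_ext G (\<phi> \<alpha>))"
      using lip_chain_dquot_ext[OF _ \<alpha>, of "r - Suc k" G] G m by (simp add: Suc_diff_Suc)
    moreover have "m \<le> r - Suc k" using m by simp
    ultimately obtain L where "L-lipschitz_on {0..1} (\<lambda>t. dquot_ext G (\<phi> \<alpha>) m (\<phi> t))"
      using lip_chain_lipschitz by blast
    then have "absolutely_continuous_on 0 1 (\<lambda>t. dquot_ext G (\<phi> \<alpha>) m (\<phi> t))"
      by (rule lipschitz_imp_absolutely_continuous_on)
    moreover have "dquot_ext G (\<phi> \<alpha>) m (\<phi> t) = D m (\<phi> t)" if t: "t \<in> {0..1}" "t \<notin> s ` {1..Suc k}" for t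
    proof -
      have z: "\<phi> t \<in> \<gamma> - insert (\<phi> \<alpha>) S"
        using off[OF t] by (simp only: nodes subset_refl)
      then show ?thesis using D[OF _ z, of m] m by (simp add: dquot_ext_def)
    qed
    ultimately show ?thesis by blast
  qed
  show "D m (\<phi> t) = arc_integral \<phi> \<phi>' (\<lambda>z. (z - \<phi> (s (Suc k))) ^ m * E (m + 1) z) (s (Suc k)) t
        / (\<phi> t - \<phi> (s (Suc k))) ^ (m + 1)"
    if m: "m \<le> r - k" and t: "t \<in> {0..1}" "t \<notin> s ` {1..Suc k}" for m t
  proof -
    have z: "\<phi> t \<in> \<gamma> - insert (\<phi> \<alpha>) S"
      using off[OF t] by (simp only: nodes subset_refl)
    obtain N where N: "negligible N"
      and N': "\<And>u. u \<in> {0..1} - N \<Longrightarrow> (G m has_field_derivative arc_deriv \<gamma> (G m) (\<phi> u)) (at (\<phi> u) within \<gamma>)"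
      using lip_chain_ae_deriv[OF G m] by blast
    have "arc_integral \<phi> \<phi>' (\<lambda>z. (z - \<phi> \<alpha>) ^ m * E (Suc m) z) \<alpha> t = dquot_num G (\<phi> \<alpha>) m (\<phi> t)"
    proof (rule arc_integral_dquot_num[OF G m _ _ \<alpha> t(1)])
      \<comment> \<open>The earlier nodes join the null set because \<open>E\<close> is identified
        only off them.\<close>
      show "negligible (N \<union> s ` {1..k})"
        by (rule negligible_Un[OF N negligible_finite]) simp
      fix u assume u: "u \<in> {0..1} - (N \<union> s ` {1..k})"
      then have "\<phi> u \<in> \<gamma> - S"
        unfolding S_def by (intro off sub) auto
      then show "(G m has_field_derivative E (Suc m) (\<phi> u)) (at (\<phi> u) within \<gamma>)"
        using N'[of u] u E[OF m] by simp
    qed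
    then show ?thesis
      using D[OF m z] dquot_eq[of "\<phi> t" "\<phi> \<alpha>" G m] z by (simp add: \<alpha>_def)
  qed
qed

end

theorem theorem1:
  fixes n :: nat
    and \<phi> \<phi>' :: "real \<Rightarrow> complex"
    and f :: "complex \<Rightarrow> complex"
  assumes n2: "n \<ge> 2"
    and inj: "inj_on \<phi> {0..1}"
    and deriv: "\<forall>t\<in>{0..1}. (\<phi> has_vector_derivative \<phi>' t) (at t within {0..1})"
    and C1: "continuous_on {0..1} \<phi>'"
    and nonzero: "\<forall>t\<in>{0..1}. \<phi>' t \<noteq> 0"
    and f_diff: "\<forall>j<n - 1. \<forall>z\<in>\<phi> ` {0..1}.
                   arc_nderiv (\<phi> ` {0..1}) j f field_differentiable (at z within \<phi> ` {0..1})"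
    and lip: "\<exists>L. L-lipschitz_on {0..1} (\<lambda>t. arc_nderiv (\<phi> ` {0..1}) (n - 1) f (\<phi> t))"
  shows "\<forall>k s. 1 \<le> k \<and> k \<le> n \<and> (\<forall>i\<in>{1..k}. s i \<in> {0..1}) \<and> inj_on s {1..k} \<longrightarrow>
     (let \<gamma> = \<phi> ` {0..1};
          D = (\<lambda>m. arc_nderiv \<gamma> m (\<lambda>\<zeta>. divdiff f k ((\<lambda>j. \<phi> (s j))(0 := \<zeta>))));
          E = (\<lambda>m. arc_nderiv \<gamma> m (\<lambda>\<zeta>. divdiff f (k - 1) ((\<lambda>j. \<phi> (s j))(0 := \<zeta>))))
      in (\<exists>B. AE t in lborel. t \<in> {0..1} \<longrightarrow> norm (D (n - k) (\<phi> t)) \<le> B)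
       \<and> (\<forall>m < n - k. \<exists>h :: real \<Rightarrow> complex. absolutely_continuous_on 0 1 h \<and>
              (\<forall>t\<in>{0..1}. t \<notin> s ` {1..k} \<longrightarrow> h t = D m (\<phi> t)))
       \<and> (\<forall>m \<le> n - k. \<forall>t1\<in>{0..1}. t1 \<notin> s ` {1..k} \<longrightarrow>
              D m (\<phi> t1) =
                arc_integral \<phi> \<phi>' (\<lambda>z. (z - \<phi> (s k)) ^ m * E (m + 1) z) (s k) t1
                / (\<phi> t1 - \<phi> (s k)) ^ (m + 1)))"
proof -
  interpret regular_arc \<phi> \<phi>'
    using inj deriv C1 nonzero by unfold_locales auto
  \<comment> \<open>Differentiability of each iterate, together with uniqueness of the arc
    derivative, shows that the chosen iterates form a true chain.\<close>
  have f: "lip_chain (n - 1) (\<lambda>j. arc_nderiv \<gamma> j f)"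
    unfolding lip_chain_def trace_def
  proof (intro conjI allI impI ballI lip)
    fix j z assume j: "j < n - 1" and z: "z \<in> \<phi> ` {0..1}"
    then obtain d where "(arc_nderiv (\<phi> ` {0..1}) j f has_field_derivative d) (at z within \<phi> ` {0..1})"
      using f_diff unfolding field_differentiable_def by blast
    then show "(arc_nderiv (\<phi> ` {0..1}) j f has_field_derivative arc_nderiv (\<phi> ` {0..1}) (Suc j) f z)
        (at z within \<phi> ` {0..1})"
      using arc_deriv_eq[unfolded trace_def, OF z] by simp
  qed
  have main: "(\<exists>B. AE t in lborel. t \<in> {0..1} \<longrightarrow>
        norm (arc_nderiv \<gamma> (n - k) (\<lambda>\<zeta>. divdiff f k ((\<lambda>j. \<phi> (s j))(0 := \<zeta>))) (\<phi> t)) \<le> B)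
     \<and> (\<forall>m < n - k. \<exists>h :: real \<Rightarrow> complex. absolutely_continuous_on 0 1 h \<and>
        (\<forall>t\<in>{0..1}. t \<notin> s ` {1..k} \<longrightarrow>
          h t = arc_nderiv \<gamma> m (\<lambda>\<zeta>. divdiff f k ((\<lambda>j. \<phi> (s j))(0 := \<zeta>))) (\<phi> t)))
     \<and> (\<forall>m \<le> n - k. \<forall>t1\<in>{0..1}. t1 \<notin> s ` {1..k} \<longrightarrow>
        arc_nderiv \<gamma> m (\<lambda>\<zeta>. divdiff f k ((\<lambda>j. \<phi> (s j))(0 := \<zeta>))) (\<phi> t1) =
          arc_integral \<phi> \<phi>' (\<lambda>z. (z - \<phi> (s k)) ^ m *
            arc_nderiv \<gamma> (m + 1) (\<lambda>\<zeta>. divdiff f (k - 1) ((\<lambda>j. \<phi> (s j))(0 := \<zeta>))) z) (s k) t1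
          / (\<phi> t1 - \<phi> (s k)) ^ (m + 1))"
    if k: "1 \<le> k" "k \<le> n" and s: "\<forall>i\<in>{1..k}. s i \<in> {0..1}" and inj_s: "inj_on s {1..k}" for k s
  proof -
    \<comment> \<open>The chain for \<open>f\<close> has length \<open>n - 1\<close> and the order
      \<open>k\<close> is written as a successor; the two shifts cancel and leave
      \<open>n - k\<close>.\<close>
    have k': "Suc (k - 1) = k" "k - 1 \<le> n - 1" "n - 1 - (k - 1) = n - k" using k by auto
    note * = divdiff_arc[OF f k'(2), of s, unfolded k'(1,3)]
    show ?thesis
      by (intro conjI allI impI ballI *) (use s inj_s in auto)
  qed
  show ?thesis
    unfolding Let_def using main unfolding trace_def by blast
qed

end
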